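(* There exist absolute constants $c,c'>0$ such that the following holds. Let $m<n$ and $q$ be positive integers, let $A\in\mathbb{R}^{m\times n}$ be a given (deterministic) matrix, and let $G\in\mathbb{R}^{q\times n}$ be a random matrix with i.i.d. $\mathcal{N}(0,1)$ entries. Then, with probability at least $1-e^{-c'q}$ over the draw of $G$, for every $x_0\in\mathbb{R}^n$ satisfying \[ \mathrm{Card}(x_0)\le \frac{q}{4c\,M^*(A)^2}, \] every solution $x^{\mathrm{LP}}$ of the convex problem \[ \text{minimize } \|x\|_1\quad\text{subject to } Ax=Ax_0,\ Gx=Gx_0, \] in the variable $x\in\mathbb{R}^n$, satisfies $x^{\mathrm{LP}}=x_0$.
   Context: $\mathrm{Card}(x)$ denotes the number of nonzero coefficients of $x\in\mathbb{R}^n$. For a matrix $A\in\mathbb{R}^{m\times n}$ define \[ \mathcal{K}(A)=\{x\in\mathbb{R}^n:\ \|x\|_1\le 1,\ Ax=0\}, \] the intersection of the unit $\ell_1$ ball with the nullspace of $A$. For a set $K\subset\mathbb{R}^n$ define \[ M^*(K)=\mathbf{E}\Big[\sup_{x\in K}\langle g,x\rangle\Big],\qquad g\sim\mathcal{N}(0,\mathbf{I}_n), \] and write $M^*(A)=M^*(\mathcal{K}(A))$. "Absolute constants" means that $c,c'$ do not depend on $m,n,q,A$ or $x_0$. *)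

theory Defs
  imports "HOL-Probability.Probability" "Jordan_Normal_Form.Matrix"
begin

unbundle no vec_syntax and no inner_syntax

definition card_nz :: "real vec \<Rightarrow> nat" where
  "card_nz x = card {i. i < dim_vec x \<and> x $ i \<noteq> 0}"

definition l1_norm :: "real vec \<Rightarrow> real" where
  "l1_norm x = (\<Sum>i<dim_vec x. \<bar>x $ i\<bar>)"

definition l1_ball_kernel :: "real mat \<Rightarrow> real vec set" where
  "l1_ball_kernel A =
     {x \<in> carrier_vec (dim_col A). l1_norm x \<le> 1 \<and> A *\<^sub>v x = 0\<^sub>v (dim_row A)}"

text \<open>The joint law of i.i.d. standard Gaussian variables indexed by \<open>I\<close>. Its outcomes are functions
  on \<open>I\<close>: a Gaussian vector is \<open>vec n g\<close> with \<open>I = {..<n}\<close>, and a Gaussian \<open>q \<times> n\<close> matrix is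
  \<open>mat q n G\<close> with \<open>I = {..<q} \<times> {..<n}\<close>.\<close>

definition iid_std_gaussian :: "'i set \<Rightarrow> ('i \<Rightarrow> real) measure" where
  "iid_std_gaussian I = (\<Pi>\<^sub>M i\<in>I. density lborel (\<lambda>x. ennreal (std_normal_density x)))"

definition M_star_set :: "nat \<Rightarrow> real vec set \<Rightarrow> real" where
  "M_star_set n K = (LINT g|iid_std_gaussian {..<n}. (SUP x\<in>K. vec n g \<bullet> x))"

definition M_star :: "real mat \<Rightarrow> real" where
  "M_star A = M_star_set (dim_col A) (l1_ball_kernel A)"

definition is_lp_solution :: "real mat \<Rightarrow> real mat \<Rightarrow> real vec \<Rightarrow> real vec \<Rightarrow> bool" where
  "is_lp_solution A G x0 x \<longleftrightarrow>
     is_arg_min l1_norm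
       (\<lambda>y. y \<in> carrier_vec (dim_col A) \<and> A *\<^sub>v y = A *\<^sub>v x0 \<and> G *\<^sub>v y = G *\<^sub>v x0) x"

end

theory Submission
  imports Defs
begin

text \<open>Write \<open>K\<close> for the section of the unit \<open>\<ell>\<^sub>1\<close> ball by the nullspace of \<open>A\<close>. If recovery
  fails for a vector supported on \<open>k\<close> coordinates, then \<open>G\<close> annihilates some \<open>h\<close> in \<open>K\<close> with half of its
  \<open>\<ell>\<^sub>1\<close> mass on those coordinates, so by Cauchy-Schwarz \<open>h\<close> has Euclidean norm at least
  \<open>1 / (2 \<surd>k)\<close>; after shrinking, \<open>G\<close> vanishes at a point of \<open>K\<close> of norm exactly
  \<open>r = \<surd>(c / q) M\<^sup>*\<close>. This is excluded by a small ball argument instead of Gordon's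
  comparison theorem. Put \<open>\<phi> t = min (\<bar>t\<bar> / r) 1\<close> and \<open>p = E \<phi>(r \<gamma>)\<close> with \<open>\<gamma>\<close> standard normal. At a
  common zero of the rows \<open>g\<^sub>i\<close> of \<open>G\<close> the process \<open>\<Sum>\<^sub>i (p - \<phi>\<langle>g\<^sub>i, x\<rangle>)\<close> equals \<open>q p\<close>. Its supremum has
  bounded differences, and symmetrization and contraction bound its mean by
  \<open>(2 / r) \<surd>q M\<^sup>* = q p / 4\<close>. Hoeffding's lemma and the symmetrization step are applied
  row by row, which gives the exponential moment directly.\<close>

section \<open>Gaussian vectors\<close>

abbreviation std_gauss :: "real measure" where
  "std_gauss \<equiv> density lborel (\<lambda>x. ennreal (std_normal_density x))"

interpretation std_gauss: prob_space std_gauss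
  by (rule prob_space_normal_density) simp

interpretation gauss_prod: product_prob_space "\<lambda>_. std_gauss" UNIV
  by standard

lemma prob_space_gaussian: "prob_space (iid_std_gaussian I)"
  unfolding iid_std_gaussian_def by (rule prob_space_PiM) (rule std_gauss.prob_space_axioms)

definition dot :: "nat \<Rightarrow> (nat \<Rightarrow> real) \<Rightarrow> (nat \<Rightarrow> real) \<Rightarrow> real" where
  "dot n g x = (\<Sum>j<n. g j * x j)"

lemma sets_gaussian[measurable_cong]: "sets (iid_std_gaussian I) = sets (\<Pi>\<^sub>M i\<in>I. borel)"
  unfolding iid_std_gaussian_def by (rule sets_PiM_cong) auto

lemma space_gaussian: "space (iid_std_gaussian I) = (\<Pi>\<^sub>E i\<in>I. UNIV)"
  unfolding iid_std_gaussian_def by (simp add: space_PiM)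

lemma measurable_dot[measurable]:
  assumes "\<And>j. j < n \<Longrightarrow> (\<lambda>w. f w j) \<in> borel_measurable M"
  shows "(\<lambda>w. dot n (f w) x) \<in> borel_measurable M"
  unfolding dot_def using assms by measurable

section \<open>Rotation invariance of a pair of independent Gaussian vectors\<close>

lemma (in prob_space) distr_pair_snd:
  assumes "sigma_finite_measure N"
  shows "distr (M \<Otimes>\<^sub>M N) N snd = N"
proof (intro measure_eqI)
  interpret N: sigma_finite_measure N by fact
  fix A assume "A \<in> sets (distr (M \<Otimes>\<^sub>M N) N snd)"
  then have A: "A \<in> sets N" by simp
  then have "emeasure (distr (M \<Otimes>\<^sub>M N) N snd) A = emeasure (M \<Otimes>\<^sub>M N) (space M \<times> A)"
    by (auto simp add: emeasure_distr space_pair_measure dest: sets.sets_into_space intro!: arg_cong2[where f=emeasure])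
  with A show "emeasure (distr (M \<Otimes>\<^sub>M N) N snd) A = emeasure N A"
    by (simp add: N.emeasure_pair_measure_Times emeasure_space_1)
qed simp

text \<open>The two scaled coordinates are independent centered normals, so their variances add up
  to 1.\<close>

lemma std_gauss_combination:
  fixes \<alpha> \<beta> :: real
  assumes ab: "\<alpha>\<^sup>2 + \<beta>\<^sup>2 = 1"
  shows "distr (std_gauss \<Otimes>\<^sub>M std_gauss) borel (\<lambda>(s, t). \<alpha> * s + \<beta> * t) = std_gauss"
proof -
  interpret P: pair_prob_space std_gauss std_gauss ..
  have X: "distributed (std_gauss \<Otimes>\<^sub>M std_gauss) lborel fst std_normal_density"
    using std_gauss.distr_pair_fst[of std_gauss] unfolding distributed_def
    by (auto cong: distr_cong)
  have Y: "distributed (std_gauss \<Otimes>\<^sub>M std_gauss) lborel snd std_normal_density"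
    using std_gauss.distr_pair_snd[of std_gauss] unfolding distributed_def
    by (auto cong: distr_cong simp: std_gauss.sigma_finite_measure_axioms)
  have aff: "distributed (std_gauss \<Otimes>\<^sub>M std_gauss) lborel (\<lambda>w. c * Z w) (normal_density 0 \<bar>c\<bar>)"
    if "distributed (std_gauss \<Otimes>\<^sub>M std_gauss) lborel Z std_normal_density" "c \<noteq> 0" for Z c
    using P.normal_density_affine[where X = Z and \<sigma> = 1 and \<mu> = 0 and \<beta> = 0 and \<alpha> = c] that by simp
  have ind: "P.indep_var borel (\<lambda>w. \<alpha> * fst w) borel (\<lambda>w. \<beta> * snd w)"
  proof -
    have "P.indep_var std_gauss fst std_gauss snd"
      unfolding P.indep_var_distribution_eq
      by (simp add: std_gauss.distr_pair_fst std_gauss.distr_pair_snd std_gauss.sigma_finite_measure_axioms)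
    from P.indep_var_compose[OF this, of "\<lambda>x. \<alpha> * x" borel "\<lambda>x. \<beta> * x" borel]
    show ?thesis by (simp add: comp_def)
  qed
  have "distributed (std_gauss \<Otimes>\<^sub>M std_gauss) lborel (\<lambda>w. \<alpha> * fst w + \<beta> * snd w) std_normal_density"
  \<comment> \<open>A zero coefficient gives a degenerate summand without a density, to which
    \<open>add_indep_normal\<close> does not apply; the other coefficient is then 1 or -1.\<close>
  proof (cases "\<alpha> = 0 \<or> \<beta> = 0")
    case False
    show ?thesis
      using P.add_indep_normal[OF ind _ _ aff[OF X] aff[OF Y]] False ab by simp
  next
    case True
    then show ?thesis
    proof
      assume "\<alpha> = 0" then show ?thesis using aff[OF Y, of \<beta>] ab by (auto simp: power2_eq_1_iff)
    next
      assume "\<beta> = 0" then show ?thesis using aff[OF X, of \<alpha>] ab by (auto simp: power2_eq_1_iff)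
    qed
  qed
  then show ?thesis
    unfolding distributed_def by (simp add: case_prod_beta' cong: distr_cong)
qed

text \<open>A product measure is determined by its values on boxes, and there the integral factors
  over the coordinates, which leaves the one-dimensional case. Its purpose is to merge two
  independent Gaussian vectors into one.\<close>

lemma gaussian_combination:
  fixes \<alpha> \<beta> :: real
  assumes ab: "\<alpha>\<^sup>2 + \<beta>\<^sup>2 = 1" and I: "finite I"
  shows "distr (iid_std_gaussian I \<Otimes>\<^sub>M iid_std_gaussian I) (iid_std_gaussian I)
     (\<lambda>(y, z). \<lambda>j\<in>I. \<alpha> * y j + \<beta> * z j) = iid_std_gaussian I" (is "distr _ _ ?T = _")
proof -
  interpret N: prob_space "iid_std_gaussian I" by (rule prob_space_gaussian)
  have T[measurable]: "?T \<in> measurable (iid_std_gaussian I \<Otimes>\<^sub>M iid_std_gaussian I) (iid_std_gaussian I)"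
    unfolding measurable_cong_sets[OF refl sets_gaussian] by measurable
  have "distr (iid_std_gaussian I \<Otimes>\<^sub>M iid_std_gaussian I) (iid_std_gaussian I) ?T = PiM I (\<lambda>_. std_gauss)"
  proof (rule gauss_prod.PiM_eqI[OF I])
    fix A :: "'a \<Rightarrow> real set" assume "\<And>i. i \<in> I \<Longrightarrow> A i \<in> sets std_gauss"
    then have A[measurable]: "\<And>i. i \<in> I \<Longrightarrow> A i \<in> sets borel" by simp
    have PA[measurable]: "Pi\<^sub>E I A \<in> sets (iid_std_gaussian I)"
      using A I by (auto simp: sets_gaussian intro!: sets_PiM_I_finite)
    have "emeasure (distr (iid_std_gaussian I \<Otimes>\<^sub>M iid_std_gaussian I) (iid_std_gaussian I) ?T) (Pi\<^sub>E I A)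
      = (\<integral>\<^sup>+w. indicator (Pi\<^sub>E I A) (?T w) \<partial>(iid_std_gaussian I \<Otimes>\<^sub>M iid_std_gaussian I))"
      by (subst nn_integral_distr[OF T, symmetric]) auto
    also have "\<dots> = (\<integral>\<^sup>+y. \<integral>\<^sup>+z. indicator (Pi\<^sub>E I A) (?T (y, z)) \<partial>iid_std_gaussian I \<partial>iid_std_gaussian I)"
      by (rule N.nn_integral_fst[symmetric]) measurable
    also have "\<dots> = (\<integral>\<^sup>+y. \<integral>\<^sup>+z. (\<Prod>j\<in>I. indicator (A j) (\<alpha> * y j + \<beta> * z j)) \<partial>iid_std_gaussian I \<partial>iid_std_gaussian I)"
    proof (intro nn_integral_cong)
      fix y z
      show "indicator (Pi\<^sub>E I A) (?T (y, z)) = (\<Prod>j\<in>I. indicator (A j) (\<alpha> * y j + \<beta> * z j) :: ennreal)"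
      proof (cases "\<forall>j\<in>I. \<alpha> * y j + \<beta> * z j \<in> A j")
        case True then show ?thesis by (auto simp: indicator_def PiE_iff)
      next
        case False
        then have "(\<Prod>j\<in>I. indicator (A j) (\<alpha> * y j + \<beta> * z j) :: ennreal) = 0"
          using I by (auto simp: indicator_def prod_zero_iff)
        then show ?thesis using False by (auto simp: indicator_def PiE_iff)
      qed
    qed
    also have "\<dots> = (\<integral>\<^sup>+y. (\<Prod>j\<in>I. \<integral>\<^sup>+t. indicator (A j) (\<alpha> * y j + \<beta> * t) \<partial>std_gauss) \<partial>iid_std_gaussian I)"
      unfolding iid_std_gaussian_def
      by (intro nn_integral_cong gauss_prod.product_nn_integral_prod I) measurable
    also have "\<dots> = (\<Prod>j\<in>I. \<integral>\<^sup>+s. \<integral>\<^sup>+t. indicator (A j) (\<alpha> * s + \<beta> * t) \<partial>std_gauss \<partial>std_gauss)"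
      unfolding iid_std_gaussian_def
      by (intro gauss_prod.product_nn_integral_prod I) measurable
    also have "\<dots> = (\<Prod>j\<in>I. emeasure std_gauss (A j))"
    proof (intro prod.cong refl)
      fix j assume j[simp]: "j \<in> I"
      have [measurable]: "A j \<in> sets borel" by (rule A) simp
      have "(\<integral>\<^sup>+s. \<integral>\<^sup>+t. indicator (A j) (\<alpha> * s + \<beta> * t) \<partial>std_gauss \<partial>std_gauss)
        = (\<integral>\<^sup>+w. indicator (A j) (case w of (s, t) \<Rightarrow> \<alpha> * s + \<beta> * t) \<partial>(std_gauss \<Otimes>\<^sub>M std_gauss))"
        by (subst std_gauss.nn_integral_fst[symmetric]) (auto simp: split_beta')
      also have "\<dots> = (\<integral>\<^sup>+u. indicator (A j) u \<partial>distr (std_gauss \<Otimes>\<^sub>M std_gauss) borel (\<lambda>(s, t). \<alpha> * s + \<beta> * t))"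
        by (subst nn_integral_distr) auto
      also have "\<dots> = emeasure std_gauss (A j)"
        unfolding std_gauss_combination[OF ab] by simp
      finally show "(\<integral>\<^sup>+s. \<integral>\<^sup>+t. indicator (A j) (\<alpha> * s + \<beta> * t) \<partial>std_gauss \<partial>std_gauss) = emeasure std_gauss (A j)" .
    qed
    finally show "emeasure (distr (iid_std_gaussian I \<Otimes>\<^sub>M iid_std_gaussian I) (iid_std_gaussian I) ?T) (Pi\<^sub>E I A)
      = (\<Prod>j\<in>I. emeasure std_gauss (A j))" .
  qed (simp add: iid_std_gaussian_def)
  then show ?thesis unfolding iid_std_gaussian_def .
qed

section \<open>Coordinates and linear forms of a Gaussian vector\<close>

lemma distr_std_gauss: "distr M std_gauss f = distr M borel f"
  by (rule distr_cong) auto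

lemma distr_lborel: "distr M lborel f = distr M borel f"
  by (rule distr_cong) auto

lemma distr_gaussian_component:
  "i \<in> I \<Longrightarrow> distr (iid_std_gaussian I) std_gauss (\<lambda>g. g i) = std_gauss"
  unfolding iid_std_gaussian_def
  by (rule distr_PiM_component[where M = "\<lambda>_. std_gauss"]) (rule std_gauss.prob_space_axioms)

lemma distr_gaussian_component_borel:
  "i \<in> I \<Longrightarrow> distr (iid_std_gaussian I) borel (\<lambda>g. g i) = std_gauss"
  using distr_gaussian_component[of i I] by (simp add: distr_std_gauss)

text \<open>Independence says that the joint law is the product of the marginal laws; here the joint
  map is the identity on the space.\<close>

lemma indep_gaussian_components:
  assumes "I \<noteq> {}"
  shows "prob_space.indep_vars (iid_std_gaussian I) (\<lambda>_. std_gauss) (\<lambda>i g. g i) I"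
proof -
  interpret N: prob_space "iid_std_gaussian I" by (rule prob_space_gaussian)
  have "distr (iid_std_gaussian I) (\<Pi>\<^sub>M i\<in>I. std_gauss) (\<lambda>g. \<lambda>i\<in>I. g i)
      = distr (iid_std_gaussian I) (iid_std_gaussian I) (\<lambda>g. g)"
    by (rule distr_cong) (auto simp: space_gaussian iid_std_gaussian_def[symmetric])
  also have "\<dots> = (\<Pi>\<^sub>M i\<in>I. distr (iid_std_gaussian I) std_gauss (\<lambda>g. g i))"
  proof -
    have "(\<Pi>\<^sub>M i\<in>I. distr (iid_std_gaussian I) std_gauss (\<lambda>g. g i)) = (\<Pi>\<^sub>M i\<in>I. std_gauss)"
      by (rule PiM_cong) (simp_all add: distr_gaussian_component)
    then show ?thesis by (simp add: iid_std_gaussian_def)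
  qed
  finally show ?thesis
    by (subst N.indep_vars_iff_distr_eq_PiM'[OF assms]) auto
qed

text \<open>A combination of independent standard normals is normal, with variance the sum of the
  squared coefficients. Hence on a Euclidean sphere the law of the linear form is the same at every
  point.\<close>

lemma distr_dot:
  assumes r: "r > 0" "(\<Sum>j<n. (x j)\<^sup>2) = r\<^sup>2"
  shows "distr (iid_std_gaussian {..<n}) borel (\<lambda>g. dot n g x / r) = std_gauss"
proof -
  \<comment> \<open>\<open>sum_indep_normal\<close> requires positive deviations, so the sum is
    restricted to the support of \<open>x\<close>, which is nonempty because
    \<open>r > 0\<close>.\<close>
  define J where "J = {j. j < n \<and> x j \<noteq> 0}"
  interpret N: prob_space "iid_std_gaussian {..<n}" by (rule prob_space_gaussian)
  have J: "finite J" "J \<subseteq> {..<n}" by (auto simp: J_def)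
  have sJ: "(\<Sum>j\<in>J. (x j)\<^sup>2) = r\<^sup>2"
    unfolding r(2)[symmetric] by (rule sum.mono_neutral_left) (auto simp: J_def)
  then have J0: "J \<noteq> {}" using r by auto
  have "N.indep_vars (\<lambda>_. std_gauss) (\<lambda>i g. g i) J"
    using N.indep_vars_subset[OF indep_gaussian_components J(2)] J0 J by auto
  from N.indep_vars_compose2[OF this, of "\<lambda>j s. x j / r * s" "\<lambda>_. borel"]
  have ind: "N.indep_vars (\<lambda>_. borel) (\<lambda>j g. x j / r * g j) J" by simp
  have "distributed (iid_std_gaussian {..<n}) lborel (\<lambda>g. \<Sum>j\<in>J. x j / r * g j)
     (normal_density (\<Sum>j\<in>J. 0) (sqrt (\<Sum>j\<in>J. \<bar>x j / r\<bar>\<^sup>2)))"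
  proof (rule N.sum_indep_normal[OF J(1) J0 ind])
    fix j assume j: "j \<in> J"
    then show "0 < \<bar>x j / r\<bar>" using r by (auto simp: J_def)
    have "distributed (iid_std_gaussian {..<n}) lborel (\<lambda>g. g j) std_normal_density"
      using distr_gaussian_component_borel[of j "{..<n}"] subsetD[OF J(2) j]
      unfolding distributed_def by (simp add: distr_lborel measurable_lborel1)
    then show "distributed (iid_std_gaussian {..<n}) lborel (\<lambda>g. x j / r * g j) (normal_density 0 \<bar>x j / r\<bar>)"
      using N.normal_density_affine[where X = "\<lambda>g. g j" and \<sigma> = 1 and \<mu> = 0 and \<beta> = 0 and \<alpha> = "x j / r"]
        j r by (simp add: J_def)
  qed
  also have "sqrt (\<Sum>j\<in>J. \<bar>x j / r\<bar>\<^sup>2) = 1"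
    using sJ r by (simp add: power_divide flip: sum_divide_distrib)
  also have "(\<lambda>g. \<Sum>j\<in>J. x j / r * g j) = (\<lambda>g. dot n g x / r)"
    unfolding dot_def sum_divide_distrib
    by (intro ext sum.mono_neutral_cong_left) (auto simp: J_def)
  finally show ?thesis
    unfolding distributed_def by (simp add: distr_lborel)
qed

lemma integrable_gaussian_component:
  assumes "i \<in> I"
  shows "integrable (iid_std_gaussian I) (\<lambda>g. g i)"
proof -
  have "integrable std_gauss (\<lambda>t. t)"
    using integrable_std_normal_distribution_moment[of 1] by simp
  then have "integrable (distr (iid_std_gaussian I) borel (\<lambda>g. g i)) (\<lambda>t. t)"
    by (simp add: distr_gaussian_component_borel assms)
  then show ?thesis by (subst (asm) integrable_distr_eq) (auto simp: assms)
qed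

lemma integrable_dot: "integrable (iid_std_gaussian {..<n}) (\<lambda>g. dot n g x)"
  unfolding dot_def by (auto intro!: integrable_gaussian_component)

lemma gaussian_integral_combination:
  fixes \<alpha> \<beta> :: real and F :: "('i \<Rightarrow> real) \<Rightarrow> real"
  assumes ab: "\<alpha>\<^sup>2 + \<beta>\<^sup>2 = 1" and I: "finite I" and F: "integrable (iid_std_gaussian I) F"
  shows "integrable (iid_std_gaussian I \<Otimes>\<^sub>M iid_std_gaussian I)
       (\<lambda>(y, z). F (\<lambda>j\<in>I. \<alpha> * y j + \<beta> * z j))" (is ?int)
    and "(LINT y|iid_std_gaussian I. LINT z|iid_std_gaussian I. F (\<lambda>j\<in>I. \<alpha> * y j + \<beta> * z j))
       = (LINT g|iid_std_gaussian I. F g)" (is ?eq)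
proof -
  interpret N: prob_space "iid_std_gaussian I" by (rule prob_space_gaussian)
  interpret NN: pair_sigma_finite "iid_std_gaussian I" "iid_std_gaussian I" ..
  let ?T = "\<lambda>(y, z). \<lambda>j\<in>I. \<alpha> * y j + \<beta> * z j"
  have T[measurable]: "?T \<in> measurable (iid_std_gaussian I \<Otimes>\<^sub>M iid_std_gaussian I) (iid_std_gaussian I)"
    unfolding measurable_cong_sets[OF refl sets_gaussian] by measurable
  have [measurable]: "F \<in> borel_measurable (iid_std_gaussian I)" using F by simp
  have "integrable (distr (iid_std_gaussian I \<Otimes>\<^sub>M iid_std_gaussian I) (iid_std_gaussian I) ?T) F"
    using F by (simp only: gaussian_combination[OF ab I])
  then show int: ?int
    by (subst (asm) integrable_distr_eq) (auto simp: case_prod_beta')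
  have "(LINT g|iid_std_gaussian I. F g)
      = (LINT g|distr (iid_std_gaussian I \<Otimes>\<^sub>M iid_std_gaussian I) (iid_std_gaussian I) ?T. F g)"
    by (simp only: gaussian_combination[OF ab I])
  also have "\<dots> = (LINT w|(iid_std_gaussian I \<Otimes>\<^sub>M iid_std_gaussian I). F (?T w))"
    by (rule integral_distr[OF T]) simp
  also have "\<dots> = (LINT y|iid_std_gaussian I. LINT z|iid_std_gaussian I. F (\<lambda>j\<in>I. \<alpha> * y j + \<beta> * z j))"
    by (subst NN.integral_fst'[symmetric]) (use int in \<open>auto simp: case_prod_beta'\<close>)
  finally show ?eq ..
qed

section \<open>Symmetrization and contraction for finite maxima\<close>

lemma Max_image_le:
  fixes f :: "'b \<Rightarrow> real"
  assumes "finite D" "D \<noteq> {}" "\<And>x. x \<in> D \<Longrightarrow> f x \<le> c"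
  shows "(MAX x\<in>D. f x) \<le> c"
  using assms by simp

text \<open>The maximum is attained. The bound is crude, but it gives an integrable majorant for any
  finite maximum of integrable functions.\<close>

lemma abs_Max_image_le:
  fixes f :: "'b \<Rightarrow> real"
  assumes D: "finite D" "D \<noteq> {}"
  shows "\<bar>MAX x\<in>D. f x\<bar> \<le> (\<Sum>x\<in>D. \<bar>f x\<bar>)"
proof -
  have "Max (f ` D) \<in> f ` D" using D by (intro Max_in) auto
  then obtain x where x: "x \<in> D" "Max (f ` D) = f x" by auto
  then show ?thesis using D member_le_sum[of x D "\<lambda>x. \<bar>f x\<bar>"] by simp
qed

lemma integrable_Max_image:
  fixes f :: "'b \<Rightarrow> 'a \<Rightarrow> real"
  assumes D: "finite D" "D \<noteq> {}" and f: "\<And>x. x \<in> D \<Longrightarrow> integrable M (f x)"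
  shows "integrable M (\<lambda>w. MAX x\<in>D. f x w)"
proof (rule Bochner_Integration.integrable_bound)
  show "integrable M (\<lambda>w. \<Sum>x\<in>D. \<bar>f x w\<bar>)" using f by (intro Bochner_Integration.integrable_sum integrable_abs)
  show "(\<lambda>w. MAX x\<in>D. f x w) \<in> borel_measurable M"
    using D f by (intro borel_measurable_Max) auto
  show "AE w in M. norm (MAX x\<in>D. f x w) \<le> norm (\<Sum>x\<in>D. \<bar>f x w\<bar>)"
    using abs_Max_image_le[OF D] by (intro AE_I2) (simp add: order_trans[OF _ abs_ge_self])
qed

text \<open>One step of the Ledoux-Talagrand contraction principle, with the random sign averaged
  out. For maximizers \<open>x\<close> and \<open>y\<close> of the two left-hand maxima, the
  Lipschitz bound turns \<open>\<phi> (u x) - \<phi> (u y)\<close> into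
  \<open>L * \<bar>u x - u y\<bar>\<close>; the order of \<open>u x\<close> and \<open>u y\<close>
  decides which of the two points is tested in the maximum with the plus sign.\<close>

lemma Max_contraction:
  fixes a u :: "'b \<Rightarrow> real" and \<phi> :: "real \<Rightarrow> real"
  assumes D: "finite D" "D \<noteq> {}" and lip: "\<And>s t. \<bar>\<phi> s - \<phi> t\<bar> \<le> L * \<bar>s - t\<bar>"
  shows "(MAX x\<in>D. a x + \<phi> (u x)) + (MAX x\<in>D. a x - \<phi> (u x))
    \<le> (MAX x\<in>D. a x + L * u x) + (MAX x\<in>D. a x - L * u x)"
proof -
  have "Max ((\<lambda>x. a x + \<phi> (u x)) ` D) \<in> (\<lambda>x. a x + \<phi> (u x)) ` D" using D by (intro Max_in) auto
  then obtain x where x: "x \<in> D" "Max ((\<lambda>x. a x + \<phi> (u x)) ` D) = a x + \<phi> (u x)" by auto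
  have "Max ((\<lambda>x. a x - \<phi> (u x)) ` D) \<in> (\<lambda>x. a x - \<phi> (u x)) ` D" using D by (intro Max_in) auto
  then obtain y where y: "y \<in> D" "Max ((\<lambda>x. a x - \<phi> (u x)) ` D) = a y - \<phi> (u y)" by auto
  have *: "\<phi> (u x) - \<phi> (u y) \<le> L * \<bar>u x - u y\<bar>" using lip[of "u x" "u y"] by linarith
  have le: "a z + L * u z \<le> (MAX x\<in>D. a x + L * u x)" "a z - L * u z \<le> (MAX x\<in>D. a x - L * u x)"
    if "z \<in> D" for z using that D by (auto intro!: Max_ge)
  show ?thesis
  proof (cases "u y \<le> u x")
    case True
    then show ?thesis using x y * le(1)[OF x(1)] le(2)[OF y(1)] by (simp add: algebra_simps)
  next
    case False
    then show ?thesis using x y * le(1)[OF y(1)] le(2)[OF x(1)] by (simp add: algebra_simps)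
  qed
qed

text \<open>The usual ghost sample is not needed: writing the summand as the mean of \<open>a + 2 p\<close> and
  \<open>a - 2 \<phi>(f)\<close>, Jensen's inequality applied to the first half brings the maximum into the form to
  which the contraction lemma applies, and symmetry of \<open>f\<close> removes the sign.\<close>

lemma (in prob_space) expectation_Max_symmetrize:
  fixes f :: "'b \<Rightarrow> 'a \<Rightarrow> real" and \<phi> :: "real \<Rightarrow> real"
  assumes D: "finite D" "D \<noteq> {}"
    and f: "\<And>x. x \<in> D \<Longrightarrow> integrable M (f x)"
    and \<phi>f: "\<And>x. x \<in> D \<Longrightarrow> integrable M (\<lambda>w. \<phi> (f x w))"
    and lip: "\<And>s t. \<bar>\<phi> s - \<phi> t\<bar> \<le> L * \<bar>s - t\<bar>"
    and p: "\<And>x. x \<in> D \<Longrightarrow> expectation (\<lambda>w. \<phi> (f x w)) = p"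
    and sym: "expectation (\<lambda>w. MAX x\<in>D. a x - 2 * L * f x w) = expectation (\<lambda>w. MAX x\<in>D. a x + 2 * L * f x w)"
  shows "expectation (\<lambda>w. MAX x\<in>D. a x + (p - \<phi> (f x w))) \<le> expectation (\<lambda>w. MAX x\<in>D. a x + 2 * L * f x w)"
proof -
  define E1 where "E1 = expectation (\<lambda>w. MAX x\<in>D. a x + 2 * \<phi> (f x w))"
  have i1: "integrable M (\<lambda>w. MAX x\<in>D. a x + 2 * \<phi> (f x w))"
    and i2: "integrable M (\<lambda>w. MAX x\<in>D. a x - 2 * \<phi> (f x w))"
    and i3: "integrable M (\<lambda>w. MAX x\<in>D. a x + 2 * L * f x w)"
    and i4: "integrable M (\<lambda>w. MAX x\<in>D. a x - 2 * L * f x w)"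
    and i5: "integrable M (\<lambda>w. MAX x\<in>D. a x + (p - \<phi> (f x w)))"
    using f \<phi>f by (auto intro!: integrable_Max_image[OF D])
  have le: "(MAX x\<in>D. a x + (p - \<phi> (f x w))) \<le> E1 / 2 + (MAX x\<in>D. a x - 2 * \<phi> (f x w)) / 2" for w
  proof (rule Max_image_le[OF D])
    fix x assume x: "x \<in> D"
    \<comment> \<open>Jensen's inequality for the maximum: each single expectation is at most the
      expected maximum \<open>E1\<close>.\<close>
    have "a x + 2 * p = expectation (\<lambda>w. a x + 2 * \<phi> (f x w))"
      using \<phi>f[OF x] p[OF x] by (simp add: prob_space)
    also have "\<dots> \<le> E1" unfolding E1_def
      using x \<phi>f by (intro integral_mono i1) (auto intro!: Max_ge D)
    finally have "a x + 2 * p \<le> E1" .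
    moreover have "a x - 2 * \<phi> (f x w) \<le> (MAX x\<in>D. a x - 2 * \<phi> (f x w))"
      using x D by (auto intro!: Max_ge)
    ultimately show "a x + (p - \<phi> (f x w)) \<le> E1 / 2 + (MAX x\<in>D. a x - 2 * \<phi> (f x w)) / 2"
      by (simp add: field_simps)
  qed
  have "expectation (\<lambda>w. MAX x\<in>D. a x + (p - \<phi> (f x w)))
      \<le> expectation (\<lambda>w. E1 / 2 + (MAX x\<in>D. a x - 2 * \<phi> (f x w)) / 2)"
    using i5 i2 by (intro integral_mono le) auto
  also have "\<dots> = E1 / 2 + expectation (\<lambda>w. MAX x\<in>D. a x - 2 * \<phi> (f x w)) / 2"
    using i2 by (simp add: prob_space)
  also have "\<dots> = expectation (\<lambda>w. (MAX x\<in>D. a x + 2 * \<phi> (f x w)) + (MAX x\<in>D. a x - 2 * \<phi> (f x w))) / 2"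
    unfolding E1_def using i1 i2 by simp
  also have "\<dots> \<le> expectation (\<lambda>w. (MAX x\<in>D. a x + 2 * L * f x w) + (MAX x\<in>D. a x - 2 * L * f x w)) / 2"
  proof (intro divide_right_mono integral_mono)
    fix w
    have "\<bar>2 * \<phi> s - 2 * \<phi> t\<bar> \<le> (2 * L) * \<bar>s - t\<bar>" for s t using lip[of s t] by linarith
    from Max_contraction[OF D this]
    show "(MAX x\<in>D. a x + 2 * \<phi> (f x w)) + (MAX x\<in>D. a x - 2 * \<phi> (f x w))
      \<le> (MAX x\<in>D. a x + 2 * L * f x w) + (MAX x\<in>D. a x - 2 * L * f x w)" by simp
  qed (use i1 i2 i3 i4 in auto)
  also have "\<dots> = expectation (\<lambda>w. MAX x\<in>D. a x + 2 * L * f x w)"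
    using i3 i4 sym by simp
  finally show ?thesis .
qed

section \<open>Exponential moments of the empirical process\<close>

lemma dot_restrict: "dot n (\<lambda>j\<in>{..<n}. \<alpha> * y j + \<beta> * z j) x = \<alpha> * dot n y x + \<beta> * dot n z x"
  by (simp add: dot_def sum_distrib_left distrib_right sum.distrib mult.assoc)

text \<open>For \<open>b = 0\<close> and \<open>c = 1\<close> this is the Gaussian width of
  \<open>D\<close>. The offset \<open>b\<close> holds, in the induction over the rows, the
  contribution of a row that is kept fixed.\<close>

definition gauss_sup :: "nat \<Rightarrow> (nat \<Rightarrow> real) set \<Rightarrow> ((nat \<Rightarrow> real) \<Rightarrow> real) \<Rightarrow> real \<Rightarrow> real" where
  "gauss_sup n D b c = (LINT g|iid_std_gaussian {..<n}. (MAX x\<in>D. b x + c * dot n g x))"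

text \<open>By rotation invariance the scales of independent Gaussian vectors add in quadrature.
  This is why \<open>q\<close> rows cost a factor \<open>sqrt q\<close> and not
  \<open>q\<close>.\<close>

lemma gauss_sup_combine:
  assumes D: "finite D" "D \<noteq> {}" and c: "c1 \<noteq> 0 \<or> c2 \<noteq> 0"
  shows "(LINT y|iid_std_gaussian {..<n}. LINT z|iid_std_gaussian {..<n}.
      (MAX x\<in>D. b x + c1 * dot n y x + c2 * dot n z x)) = gauss_sup n D b (sqrt (c1\<^sup>2 + c2\<^sup>2))"
    (is "?lhs = _")
proof -
  interpret N: prob_space "iid_std_gaussian {..<n}" by (rule prob_space_gaussian)
  let ?C = "sqrt (c1\<^sup>2 + c2\<^sup>2)"
  have C: "?C > 0" using c by (auto simp: add_pos_nonneg add_nonneg_pos)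
  have ab: "(c1 / ?C)\<^sup>2 + (c2 / ?C)\<^sup>2 = 1"
    using C c by (auto simp: power_divide simp flip: add_divide_distrib)
  have "?lhs = (LINT y|iid_std_gaussian {..<n}. LINT z|iid_std_gaussian {..<n}.
      (MAX x\<in>D. b x + ?C * dot n (\<lambda>j\<in>{..<n}. c1 / ?C * y j + c2 / ?C * z j) x))"
    unfolding dot_restrict using C c by (auto simp: distrib_left add.assoc)
  also have "\<dots> = gauss_sup n D b ?C"
    unfolding gauss_sup_def
    by (rule gaussian_integral_combination(2)[OF ab]) (auto intro!: integrable_Max_image D integrable_dot)
  finally show ?thesis .
qed

text \<open>Merging with a second vector of coefficient 0 replaces a nonzero scale by its absolute
  value, so \<open>c\<close> and \<open>- c\<close> give the same result.\<close>

lemma gauss_sup_uminus: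
  assumes D: "finite D" "D \<noteq> {}"
  shows "gauss_sup n D b (- c) = gauss_sup n D b c"
proof (cases "c = 0")
  case False
  interpret N: prob_space "iid_std_gaussian {..<n}" by (rule prob_space_gaussian)
  have *: "gauss_sup n D b \<bar>c'\<bar> = gauss_sup n D b c'" if "c' \<noteq> 0" for c'
    using gauss_sup_combine[OF D, of c' 0 n b] that
    by (simp add: gauss_sup_def N.prob_space)
  show ?thesis using *[of c] *[of "-c"] False by simp
qed simp

lemma measurable_dot_row:
  assumes "i \<in> I"
  shows "(\<lambda>\<omega>. dot n (\<omega> i) x) \<in> borel_measurable (\<Pi>\<^sub>M i\<in>I. iid_std_gaussian {..<n})"
proof (rule measurable_compose[OF measurable_component_singleton[OF assms]])
  show "(\<lambda>g. dot n g x) \<in> borel_measurable (iid_std_gaussian {..<n})" by measurable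
qed

text \<open>Induction on the number of rows. After the induction hypothesis has replaced all rows but the new
  one, \<open>y\<close>, by a single Gaussian vector, the remaining function of \<open>y\<close> still varies by at most 1, so
  Hoeffding's lemma moves the expectation over \<open>y\<close> into the exponent, where the new row can be
  symmetrized and merged with that Gaussian vector.\<close>

lemma exp_moment_Max_rows:
  fixes n :: nat and D :: "(nat \<Rightarrow> real) set" and \<phi> :: "real \<Rightarrow> real"
  defines "N \<equiv> iid_std_gaussian {..<n}"
  assumes D: "finite D" "D \<noteq> {}"
    and \<phi>_meas[measurable]: "\<phi> \<in> borel_measurable borel"
    and \<phi>01: "\<And>t. 0 \<le> \<phi> t" "\<And>t. \<phi> t \<le> 1"
    and lip: "\<And>s t. \<bar>\<phi> s - \<phi> t\<bar> \<le> L * \<bar>s - t\<bar>" and L: "L > 0"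
    and p: "\<And>x. x \<in> D \<Longrightarrow> (LINT g|N. \<phi> (dot n g x)) = p"
    and s: "s > 0"
  shows "(\<integral>\<^sup>+\<omega>. ennreal (exp (s * (MAX x\<in>D. a x + (\<Sum>i<q. p - \<phi> (dot n (\<omega> i) x))))) \<partial>(\<Pi>\<^sub>M i\<in>{..<q}. N))
    \<le> ennreal (exp (real q * s\<^sup>2 / 8 + s * gauss_sup n D a (2 * L * sqrt q)))"
\<comment> \<open>The offset has to vary: the induction hypothesis is used with the term of the new
  row added to \<open>a\<close>.\<close>
proof (induction q arbitrary: a)
  case 0
  interpret N: prob_space N unfolding N_def by (rule prob_space_gaussian)
  interpret Q: product_prob_space "\<lambda>_::nat. N" UNIV ..
  interpret P: prob_space "\<Pi>\<^sub>M i\<in>({}::nat set). N"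
    by (rule prob_space_PiM) (rule N.prob_space_axioms)
  show ?case using P.emeasure_space_1 by (simp add: Q.nn_integral_empty gauss_sup_def N_def[symmetric] N.prob_space)
next
  case (Suc q)
  interpret N: prob_space N unfolding N_def by (rule prob_space_gaussian)
  interpret Q: product_prob_space "\<lambda>_::nat. N" UNIV ..
  interpret NN: pair_sigma_finite N N ..
  have [measurable_cong]: "sets N = sets (\<Pi>\<^sub>M i\<in>{..<n}. borel)" unfolding N_def by (rule sets_gaussian)
  have int_dot: "integrable N (\<lambda>g. dot n g x)" for x unfolding N_def by (rule integrable_dot)
  have int_\<phi>: "integrable N (\<lambda>g. \<phi> (dot n g x))" for x
    by (rule N.integrable_const_bound[where B = 1]) (use \<phi>01 in auto)
  let ?c = "2 * L * sqrt q"
  \<comment> \<open>\<open>H y\<close> is the expected maximum that the induction hypothesis leaves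
    in the exponent once the new row \<open>y\<close> is fixed; \<open>h\<close> is its integrand,
    to which Fubini's theorem is applied.\<close>
  define H where "H y = gauss_sup n D (\<lambda>x. a x + (p - \<phi> (dot n y x))) ?c" for y
  define h where "h y z = (MAX x\<in>D. a x + ?c * dot n z x + (p - \<phi> (dot n y x)))" for y z
  have H_h: "H y = (LINT z|N. h y z)" for y
    by (simp add: H_def h_def gauss_sup_def N_def add.assoc add.commute[of "_ * _"])
  have h_meas[measurable]: "case_prod h \<in> borel_measurable (N \<Otimes>\<^sub>M N)"
    unfolding h_def case_prod_beta' using D(1) by measurable
  have H_meas[measurable]: "H \<in> borel_measurable N" unfolding H_h by measurable
  have int_\<phi>_fst: "integrable (N \<Otimes>\<^sub>M N) (\<lambda>w. \<phi> (dot n (fst w) x))" for x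
  proof -
    have "integrable (distr (N \<Otimes>\<^sub>M N) N fst) (\<lambda>g. \<phi> (dot n g x))"
      using int_\<phi>[of x] by (simp only: N.distr_pair_fst)
    then show ?thesis by (subst (asm) integrable_distr_eq) auto
  qed
  have int_fst: "integrable (N \<Otimes>\<^sub>M N) (\<lambda>w. dot n (fst w) x)" for x
  proof -
    have "integrable (distr (N \<Otimes>\<^sub>M N) N fst) (\<lambda>g. dot n g x)"
      using int_dot[of x] by (simp only: N.distr_pair_fst)
    then show ?thesis by (subst (asm) integrable_distr_eq) auto
  qed
  have int_snd: "integrable (N \<Otimes>\<^sub>M N) (\<lambda>w. dot n (snd w) x)" for x
  proof -
    have "integrable (distr (N \<Otimes>\<^sub>M N) N snd) (\<lambda>g. dot n g x)"
      using int_dot[of x] by (simp only: N.distr_pair_snd[OF N.sigma_finite_measure_axioms])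
    then show ?thesis by (subst (asm) integrable_distr_eq) auto
  qed
  have int_const: "integrable (N \<Otimes>\<^sub>M N) (\<lambda>w. C)" for C :: real
  proof -
    interpret P: pair_prob_space N N ..
    show ?thesis by simp
  qed
  have int_pair: "integrable (N \<Otimes>\<^sub>M N) (case_prod h)"
    unfolding h_def case_prod_beta'
    by (intro integrable_Max_image D Bochner_Integration.integrable_add Bochner_Integration.integrable_diff
        integrable_mult_right int_\<phi>_fst int_snd int_const)
  \<comment> \<open>The two ends come from replacing \<phi> by 0 and by 1. The length 1 of the
    interval gives the term \<open>s\<^sup>2 / 8\<close> for each row.\<close>
  have H_range: "H y \<in> {gauss_sup n D (\<lambda>x. a x + p) ?c - 1 .. gauss_sup n D (\<lambda>x. a x + p) ?c}" for y
  proof -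
    have int: "integrable N (\<lambda>g. MAX x\<in>D. b x + ?c * dot n g x)" for b
      by (intro integrable_Max_image D Bochner_Integration.integrable_add integrable_mult_right int_dot) simp
    have "H y \<le> gauss_sup n D (\<lambda>x. a x + p) ?c"
      unfolding H_def gauss_sup_def N_def[symmetric]
    proof (intro integral_mono int Max_image_le[OF D])
      fix g x assume "x \<in> D"
      then have "a x + p + ?c * dot n g x \<le> (MAX x\<in>D. a x + p + ?c * dot n g x)"
        using D by (intro Max_ge) auto
      then show "a x + (p - \<phi> (dot n y x)) + ?c * dot n g x \<le> (MAX x\<in>D. a x + p + ?c * dot n g x)"
        using \<phi>01(1)[of "dot n y x"] by linarith
    qed
    moreover have "gauss_sup n D (\<lambda>x. a x + p) ?c \<le> (LINT g|N. (MAX x\<in>D. a x + (p - \<phi> (dot n y x)) + ?c * dot n g x) + 1)"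
      unfolding gauss_sup_def N_def[symmetric]
    proof (intro integral_mono int Max_image_le[OF D] Bochner_Integration.integrable_add)
      fix g x assume "x \<in> D"
      then have "a x + (p - \<phi> (dot n y x)) + ?c * dot n g x \<le> (MAX x\<in>D. a x + (p - \<phi> (dot n y x)) + ?c * dot n g x)"
        using D by (intro Max_ge) auto
      then show "a x + p + ?c * dot n g x \<le> (MAX x\<in>D. a x + (p - \<phi> (dot n y x)) + ?c * dot n g x) + 1"
        using \<phi>01(2)[of "dot n y x"] by linarith
    qed auto
    then have "gauss_sup n D (\<lambda>x. a x + p) ?c \<le> H y + 1"
      unfolding H_def gauss_sup_def N_def[symmetric] using int by (simp add: N.prob_space)
    ultimately show ?thesis by simp
  qed
  interpret I: interval_bounded_random_variable N H
    "gauss_sup n D (\<lambda>x. a x + p) ?c - 1" "gauss_sup n D (\<lambda>x. a x + p) ?c"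
    by unfold_locales (use H_range in auto)
  have EH: "N.expectation H \<le> gauss_sup n D a (2 * L * sqrt (Suc q))"
  proof -
    \<comment> \<open>The order of integration is exchanged so that, for fixed \<open>z\<close>, the
      terms in \<open>z\<close> become part of the offset while the row \<open>y\<close> is
      symmetrized.\<close>
    have "N.expectation H = (LINT z|N. LINT y|N. h y z)"
      unfolding H_h using NN.Fubini_integral[OF int_pair] by simp
    also have "\<dots> \<le> (LINT z|N. LINT y|N. (MAX x\<in>D. a x + ?c * dot n z x + 2 * L * dot n y x))"
    proof (rule integral_mono)
      show "integrable N (\<lambda>z. LINT y|N. h y z)"
        by (rule NN.integrable_snd[OF int_pair])
      have "integrable (N \<Otimes>\<^sub>M N) (\<lambda>(y, z). MAX x\<in>D. a x + ?c * dot n z x + 2 * L * dot n y x)"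
        unfolding case_prod_beta'
        by (intro integrable_Max_image D Bochner_Integration.integrable_add integrable_mult_right int_fst int_snd int_const)
      then show "integrable N (\<lambda>z. LINT y|N. (MAX x\<in>D. a x + ?c * dot n z x + 2 * L * dot n y x))"
        by (rule NN.integrable_snd)
      fix z
      show "(LINT y|N. h y z) \<le> (LINT y|N. (MAX x\<in>D. a x + ?c * dot n z x + 2 * L * dot n y x))"
        unfolding h_def
      proof (rule N.expectation_Max_symmetrize[OF D])
        show "(LINT y|N. (MAX x\<in>D. a x + ?c * dot n z x - 2 * L * dot n y x))
            = (LINT y|N. (MAX x\<in>D. a x + ?c * dot n z x + 2 * L * dot n y x))"
          using gauss_sup_uminus[OF D, of n "\<lambda>x. a x + ?c * dot n z x" "2 * L"]
          by (simp add: gauss_sup_def N_def)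
      qed (rule int_dot int_\<phi> lip p | assumption)+
    qed
    also have "\<dots> = gauss_sup n D a (sqrt (?c\<^sup>2 + (2 * L)\<^sup>2))"
      unfolding N_def using L by (intro gauss_sup_combine D) simp
    \<comment> \<open>The squared scales of the old rows and of the new one add up:
      \<open>(2 * L)\<^sup>2 * q + (2 * L)\<^sup>2\<close>.\<close>
    also have "sqrt (?c\<^sup>2 + (2 * L)\<^sup>2) = 2 * L * sqrt (Suc q)"
    proof -
      have "?c\<^sup>2 + (2 * L)\<^sup>2 = (2 * L)\<^sup>2 * (Suc q)" by (simp add: power_mult_distrib algebra_simps)
      then show ?thesis using L by (simp add: real_sqrt_mult)
    qed
    finally show ?thesis .
  qed
  let ?f = "\<lambda>\<omega>. ennreal (exp (s * (MAX x\<in>D. a x + (\<Sum>i<Suc q. p - \<phi> (dot n (\<omega> i) x)))))"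
  have "(\<integral>\<^sup>+\<omega>. ?f \<omega> \<partial>(\<Pi>\<^sub>M i\<in>{..<Suc q}. N)) = (\<integral>\<^sup>+y. \<integral>\<^sup>+\<omega>. ?f (fun_upd \<omega> q y) \<partial>(\<Pi>\<^sub>M i\<in>{..<q}. N) \<partial>N)"
  proof -
    have [measurable]: "(\<lambda>\<omega>. dot n (\<omega> i) x) \<in> borel_measurable (\<Pi>\<^sub>M i\<in>insert q {..<q}. N)"
      if "i < Suc q" for i x
      unfolding N_def by (rule measurable_dot_row) (use that in auto)
    have "?f \<in> borel_measurable (\<Pi>\<^sub>M i\<in>insert q {..<q}. N)"
      using D(1) by measurable
    then show ?thesis
      unfolding lessThan_Suc by (intro Q.product_nn_integral_insert_rev) auto
  qed
  also have "\<dots> = (\<integral>\<^sup>+y. \<integral>\<^sup>+\<omega>. ennreal (exp (s * (MAX x\<in>D. (a x + (p - \<phi> (dot n y x))) + (\<Sum>i<q. p - \<phi> (dot n (\<omega> i) x)))))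
      \<partial>(\<Pi>\<^sub>M i\<in>{..<q}. N) \<partial>N)"
    by (simp add: algebra_simps)
  also have "\<dots> \<le> (\<integral>\<^sup>+y. ennreal (exp (real q * s\<^sup>2 / 8 + s * H y)) \<partial>N)"
    unfolding H_def by (intro nn_integral_mono Suc.IH)
  also have "\<dots> = (\<integral>\<^sup>+y. ennreal (exp (real q * s\<^sup>2 / 8 + s * N.expectation H)) * ennreal (exp (s * (H y - N.expectation H))) \<partial>N)"
    by (intro nn_integral_cong) (simp add: ennreal_mult'[symmetric] exp_add[symmetric] algebra_simps)
  also have "\<dots> = ennreal (exp (real q * s\<^sup>2 / 8 + s * N.expectation H)) * (\<integral>\<^sup>+y. ennreal (exp (s * (H y - N.expectation H))) \<partial>N)"
    by (rule nn_integral_cmult) measurable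
  also have "\<dots> \<le> ennreal (exp (real q * s\<^sup>2 / 8 + s * N.expectation H)) * ennreal (exp (s\<^sup>2 / 8))"
    using I.Hoeffdings_lemma_nn_integral[OF s] by (intro mult_left_mono) auto
  also have "\<dots> = ennreal (exp (real (Suc q) * s\<^sup>2 / 8 + s * N.expectation H))"
    by (simp add: ennreal_mult'[symmetric] exp_add[symmetric] field_simps)
  also have "\<dots> \<le> ennreal (exp (real (Suc q) * s\<^sup>2 / 8 + s * gauss_sup n D a (2 * L * sqrt (Suc q))))"
    using EH s by (intro ennreal_leI) simp
  finally show ?case .
qed

section \<open>The small ball tail bound\<close>

text \<open>The absolute constant \<open>p\<close> from which both constants of the theorem are
  built; what matters is its positivity.\<close>

definition trunc_mean :: real where
  "trunc_mean = (LINT t|std_gauss. min \<bar>t\<bar> 1)"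

text \<open>If the mean of this nonnegative function were 0, positivity of the density would force
  \<open>t = 0\<close> for Lebesgue almost every \<open>t\<close>.\<close>

lemma trunc_mean_pos: "trunc_mean > 0"
proof -
  have int: "integrable std_gauss (\<lambda>t. min \<bar>t\<bar> 1)"
    by (rule std_gauss.integrable_const_bound[where B = 1]) auto
  have "trunc_mean \<noteq> 0"
  proof
    assume "trunc_mean = 0"
    then have "AE t in std_gauss. min \<bar>t\<bar> 1 = 0"
      unfolding trunc_mean_def using int by (subst (asm) integral_nonneg_eq_0_iff_AE) auto
    then have "AE t in lborel. t = (0::real)"
      by (subst (asm) AE_density) (auto simp: normal_density_pos min_def split: if_splits)
    moreover have "AE t in lborel. t \<noteq> (0::real)"
      by (rule AE_lborel_singleton)
    ultimately have "AE t::real in lborel. False" by eventually_elim simp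
    then show False by (simp add: eventually_ae_filter null_sets_def subset_UNIV top_unique)
  qed
  moreover have "trunc_mean \<ge> 0" unfolding trunc_mean_def by (intro Bochner_Integration.integral_nonneg) auto
  ultimately show ?thesis by simp
qed

lemma expectation_trunc_dot:
  assumes r: "r > 0" "(\<Sum>j<n. (x j)\<^sup>2) = r\<^sup>2"
  shows "(LINT g|iid_std_gaussian {..<n}. min \<bar>dot n g x / r\<bar> 1) = trunc_mean"
proof -
  have "(LINT g|iid_std_gaussian {..<n}. min \<bar>dot n g x / r\<bar> 1)
      = (LINT t|distr (iid_std_gaussian {..<n}) borel (\<lambda>g. dot n g x / r). min \<bar>t\<bar> 1)"
    by (rule integral_distr[symmetric]) measurable
  then show ?thesis by (simp add: distr_dot[OF r] trunc_mean_def)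
qed

text \<open>A Chernoff bound. At a common zero of the rows the sum equals
  \<open>q * trunc_mean\<close>; the lower level with factor 3/4 leaves room for approximating such
  a zero by points of a countable dense set.\<close>

lemma finite_small_ball_tail:
  fixes n q :: nat and D :: "(nat \<Rightarrow> real) set"
  defines "Q \<equiv> (\<Pi>\<^sub>M i\<in>{..<q}. iid_std_gaussian {..<n})"
  assumes D: "finite D" "D \<noteq> {}" and r: "r > 0" and sphere: "\<And>x. x \<in> D \<Longrightarrow> (\<Sum>j<n. (x j)\<^sup>2) = r\<^sup>2"
    and width: "gauss_sup n D (\<lambda>_. 0) (2 / r * sqrt q) \<le> q * trunc_mean / 4"
  defines "E \<equiv> {\<omega> \<in> space Q. \<exists>x\<in>D. 3 / 4 * (q * trunc_mean) < (\<Sum>i<q. trunc_mean - min \<bar>dot n (\<omega> i) x / r\<bar> 1)}"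
  shows "E \<in> sets Q" "emeasure Q E \<le> ennreal (exp (- (trunc_mean\<^sup>2 / 2) * q))"
proof -
  let ?p = trunc_mean and ?\<phi> = "\<lambda>t. min \<bar>t / r\<bar> 1"
  define X where "X \<omega> x = (\<Sum>i<q. ?p - ?\<phi> (dot n (\<omega> i) x))" for \<omega> x
  \<comment> \<open>This minimizes the exponent
    \<open>- 3/4 * s * q * p + q * s\<^sup>2 / 8 + s * q * p / 4\<close>, with minimum
    \<open>- q * p\<^sup>2 / 2\<close>.\<close>
  define s where "s = 2 * ?p"
  have s: "s > 0" using trunc_mean_pos by (simp add: s_def)
  have [measurable]: "(\<lambda>\<omega>. dot n (\<omega> i) x) \<in> borel_measurable Q" if "i < q" for i x
    unfolding Q_def by (rule measurable_dot_row) (use that in auto)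
  have X[measurable]: "(\<lambda>\<omega>. X \<omega> x) \<in> borel_measurable Q" for x unfolding X_def by measurable
  show E[measurable]: "E \<in> sets Q"
    unfolding E_def X_def[symmetric] using D(1) by measurable
  have "emeasure Q E = (\<integral>\<^sup>+\<omega>. indicator E \<omega> \<partial>Q)" by simp
  \<comment> \<open>Exponential Markov inequality. The summand 0 stands for the offset
    \<open>a\<close> of \<open>exp_moment_Max_rows\<close>.\<close>
  also have "\<dots> \<le> (\<integral>\<^sup>+\<omega>. ennreal (exp (- (s * (3 / 4 * (q * ?p))))) * ennreal (exp (s * (MAX x\<in>D. 0 + X \<omega> x))) \<partial>Q)"
  proof (intro nn_integral_mono)
    fix \<omega>
    show "indicator E \<omega> \<le> ennreal (exp (- (s * (3 / 4 * (q * ?p))))) * ennreal (exp (s * (MAX x\<in>D. 0 + X \<omega> x)))"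
    proof (cases "\<omega> \<in> E")
      case True
      then obtain x where x: "x \<in> D" "3 / 4 * (q * ?p) < X \<omega> x" by (auto simp: E_def X_def)
      then have "X \<omega> x \<le> (MAX x\<in>D. 0 + X \<omega> x)" using D by (auto intro!: Max_ge)
      then have "3 / 4 * (q * ?p) \<le> (MAX x\<in>D. 0 + X \<omega> x)" using x by linarith
      then have "s * (3 / 4 * (q * ?p)) \<le> s * (MAX x\<in>D. 0 + X \<omega> x)" using s by (intro mult_left_mono) auto
      then have "1 \<le> exp (- (s * (3 / 4 * (q * ?p))) + s * (MAX x\<in>D. 0 + X \<omega> x))" by simp
      then show ?thesis using True by (simp add: ennreal_mult'[symmetric] exp_add[symmetric])
    qed simp
  qed
  also have "\<dots> = ennreal (exp (- (s * (3 / 4 * (q * ?p))))) * (\<integral>\<^sup>+\<omega>. ennreal (exp (s * (MAX x\<in>D. 0 + X \<omega> x))) \<partial>Q)"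
    using D(1) by (intro nn_integral_cmult) measurable
  also have "\<dots> \<le> ennreal (exp (- (s * (3 / 4 * (q * ?p)))))
      * ennreal (exp (real q * s\<^sup>2 / 8 + s * gauss_sup n D (\<lambda>_. 0) (2 * (1 / r) * sqrt q)))"
    unfolding X_def Q_def
  proof (intro mult_left_mono exp_moment_Max_rows D s)
    fix a b
    have "\<bar>?\<phi> a - ?\<phi> b\<bar> \<le> \<bar>\<bar>a / r\<bar> - \<bar>b / r\<bar>\<bar>" by linarith
    also have "\<dots> \<le> \<bar>a / r - b / r\<bar>" by linarith
    also have "\<dots> = 1 / r * \<bar>a - b\<bar>" using r by (simp add: abs_divide flip: diff_divide_distrib)
    finally show "\<bar>?\<phi> a - ?\<phi> b\<bar> \<le> 1 / r * \<bar>a - b\<bar>" .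
  next
    fix x assume "x \<in> D"
    then show "(LINT g|iid_std_gaussian {..<n}. ?\<phi> (dot n g x)) = ?p"
      using expectation_trunc_dot[OF r sphere] by simp
  qed (use r in auto)
  also have "\<dots> = ennreal (exp (- (s * (3 / 4 * (q * ?p))) + (real q * s\<^sup>2 / 8 + s * gauss_sup n D (\<lambda>_. 0) (2 / r * sqrt q))))"
    by (simp add: ennreal_mult'[symmetric] exp_add[symmetric])
  also have "\<dots> \<le> ennreal (exp (- (?p\<^sup>2 / 2) * q))"
  proof -
    have "s * gauss_sup n D (\<lambda>_. 0) (2 / r * sqrt q) \<le> s * (q * ?p / 4)"
      using s width by (intro mult_left_mono) auto
    then have "- (s * (3 / 4 * (q * ?p))) + (real q * s\<^sup>2 / 8 + s * gauss_sup n D (\<lambda>_. 0) (2 / r * sqrt q)) \<le> - (?p\<^sup>2 / 2) * q"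
      unfolding s_def by (simp add: power2_eq_square algebra_simps)
    then show ?thesis by (intro ennreal_leI) simp
  qed
  finally show "emeasure Q E \<le> ennreal (exp (- (?p\<^sup>2 / 2) * q))" .
qed

lemma continuous_on_dot: "continuous_on UNIV (\<lambda>x. dot n g x)"
  unfolding dot_def by (intro continuous_intros continuous_on_product_coordinates)

text \<open>The finite bound does not depend on the finite set, so it passes to a countable dense
  subset of \<open>T\<close>. A common zero may lie outside that subset, but the set where the
  continuous sum exceeds 3/4 of its value there is open and so contains a point of the
  subset.\<close>

lemma small_ball_tail:
  fixes n q :: nat and T :: "(nat \<Rightarrow> real) set"
  defines "Q \<equiv> (\<Pi>\<^sub>M i\<in>{..<q}. iid_std_gaussian {..<n})"
  assumes r: "r > 0" and q: "q > 0" and sphere: "\<And>x. x \<in> T \<Longrightarrow> (\<Sum>j<n. (x j)\<^sup>2) = r\<^sup>2"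
    and width: "\<And>D. finite D \<Longrightarrow> D \<noteq> {} \<Longrightarrow> D \<subseteq> T \<Longrightarrow> gauss_sup n D (\<lambda>_. 0) (2 / r * sqrt q) \<le> q * trunc_mean / 4"
    and B: "B \<subseteq> {\<omega> \<in> space Q. \<exists>x\<in>T. \<forall>i<q. dot n (\<omega> i) x = 0}"
  shows "measure Q B \<le> exp (- (trunc_mean\<^sup>2 / 2) * q)"
proof (cases "T = {}")
  case True
  then show ?thesis using B by simp
next
  case False
  interpret Q: prob_space Q unfolding Q_def by (intro prob_space_PiM prob_space_gaussian)
  obtain D where D: "countable D" "D \<subseteq> T" "T \<subseteq> closure D" by (rule separable)
  have "D \<noteq> {}" using D False by auto
  \<comment> \<open>Initial segments of an enumeration increase, so continuity from below keeps the
    same bound for the union, without the loss of a union bound.\<close>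
  define Dk where "Dk k = from_nat_into D ` {..k}" for k
  have Dk: "finite (Dk k)" "Dk k \<noteq> {}" "Dk k \<subseteq> D" for k
    using from_nat_into[OF \<open>D \<noteq> {}\<close>] by (auto simp: Dk_def)
  define E where "E k = {\<omega> \<in> space Q. \<exists>x\<in>Dk k. 3 / 4 * (q * trunc_mean) < (\<Sum>i<q. trunc_mean - min \<bar>dot n (\<omega> i) x / r\<bar> 1)}" for k
  have E: "E k \<in> sets Q" "emeasure Q (E k) \<le> ennreal (exp (- (trunc_mean\<^sup>2 / 2) * q))" for k
  proof -
    have "Dk k \<subseteq> T" using Dk(3)[of k] D(2) by simp
    then show "E k \<in> sets Q" "emeasure Q (E k) \<le> ennreal (exp (- (trunc_mean\<^sup>2 / 2) * q))"
      unfolding E_def Q_def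
      by (intro finite_small_ball_tail Dk r width sphere; blast)+
  qed
  have inc: "incseq E" unfolding incseq_def E_def Dk_def by fastforce
  have U: "emeasure Q (\<Union>k. E k) \<le> ennreal (exp (- (trunc_mean\<^sup>2 / 2) * q))"
  proof -
    have "emeasure Q (\<Union>k. E k) = (SUP k. emeasure Q (E k))"
      using E(1) inc by (intro SUP_emeasure_incseq[symmetric]) auto
    also have "\<dots> \<le> ennreal (exp (- (trunc_mean\<^sup>2 / 2) * q))"
      by (rule SUP_least) (rule E(2))
    finally show ?thesis .
  qed
  have "B \<subseteq> (\<Union>k. E k)"
  proof
    fix \<omega> assume "\<omega> \<in> B"
    with B obtain x where \<omega>: "\<omega> \<in> space Q" and x: "x \<in> T" "\<And>i. i < q \<Longrightarrow> dot n (\<omega> i) x = 0" by blast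
    let ?f = "\<lambda>x. \<Sum>i<q. trunc_mean - min \<bar>dot n (\<omega> i) x / r\<bar> 1"
    let ?U = "{x. 3 / 4 * (q * trunc_mean) < ?f x}"
    have "open ?U"
      using r by (intro open_Collect_less continuous_intros continuous_on_dot) auto
    moreover have "x \<in> ?U" using x(2) q trunc_mean_pos by simp
    moreover have "x \<in> closure D" using x D by auto
    ultimately obtain y where y: "y \<in> D" "y \<in> ?U"
      using open_Int_closure_eq_empty[of ?U D] by blast
    then obtain k where "y = from_nat_into D k" using D(1) from_nat_into_surj by metis
    then have "\<omega> \<in> E k" using y \<omega> by (auto simp: E_def Dk_def)
    then show "\<omega> \<in> (\<Union>k. E k)" by auto
  qed
  then have "measure Q B \<le> measure Q (\<Union>k. E k)"
    by (intro Q.finite_measure_mono) (use E in auto)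
  also have "\<dots> \<le> exp (- (trunc_mean\<^sup>2 / 2) * q)"
    using U by (simp add: Q.emeasure_eq_measure)
  finally show ?thesis .
qed

section \<open>Sections of the \<open>\<ell>\<^sub>1\<close> ball and their width\<close>

lemma dot_diff: "dot n g (\<lambda>j. x j - y j) = dot n g x - dot n g y"
  by (simp add: dot_def right_diff_distrib sum_subtractf)

lemma dot_scale: "dot n g (\<lambda>j. c * x j) = c * dot n g x"
  by (simp add: dot_def sum_distrib_left mult_ac)

lemma dot_cong: "(\<And>j. j < n \<Longrightarrow> g j = g' j) \<Longrightarrow> (\<And>j. j < n \<Longrightarrow> x j = x' j) \<Longrightarrow> dot n g x = dot n g' x'"
  by (simp add: dot_def)

definition l1 :: "nat \<Rightarrow> (nat \<Rightarrow> real) \<Rightarrow> real" where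
  "l1 n x = (\<Sum>j<n. \<bar>x j\<bar>)"

lemma l1_cong: "(\<And>j. j < n \<Longrightarrow> x j = x' j) \<Longrightarrow> l1 n x = l1 n x'"
  by (simp add: l1_def)

lemma l1_ge_component: "j < n \<Longrightarrow> \<bar>x j\<bar> \<le> l1 n x"
  unfolding l1_def by (rule member_le_sum) auto

lemma l1_nonneg: "l1 n x \<ge> 0"
  by (simp add: l1_def sum_nonneg)

lemma l1_scale: "l1 n (\<lambda>j. c * x j) = \<bar>c\<bar> * l1 n x"
  by (simp add: l1_def abs_mult sum_distrib_left)

lemma continuous_on_l1: "continuous_on UNIV (l1 n)"
  unfolding l1_def by (intro continuous_intros continuous_on_product_coordinates)

lemma scalar_prod_vec: "vec n g \<bullet> vec n x = dot n g x"
  by (simp add: scalar_prod_def dot_def atLeast0LessThan)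

lemma l1_norm_vec: "l1_norm (vec n x) = l1 n x"
  by (simp add: l1_norm_def l1_def)

lemma card_nz_vec: "card_nz (vec n x) = card {j. j < n \<and> x j \<noteq> 0}"
  unfolding card_nz_def by (rule arg_cong[where f = card]) auto

lemma mult_mat_vec_eq_iff:
  assumes "A \<in> carrier_mat m n"
  shows "A *\<^sub>v vec n x = A *\<^sub>v vec n y \<longleftrightarrow> (\<forall>i<m. dot n (\<lambda>j. A $$ (i, j)) x = dot n (\<lambda>j. A $$ (i, j)) y)"
  using assms by (auto simp: vec_eq_iff scalar_prod_def dot_def atLeast0LessThan)

lemma mult_mat_vec_eq_0_iff:
  assumes "A \<in> carrier_mat m n"
  shows "A *\<^sub>v vec n x = 0\<^sub>v m \<longleftrightarrow> (\<forall>i<m. dot n (\<lambda>j. A $$ (i, j)) x = 0)"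
  using assms by (auto simp: vec_eq_iff scalar_prod_def dot_def atLeast0LessThan)

lemma carrier_vecE:
  assumes "y \<in> carrier_vec n"
  obtains f where "y = vec n f" "\<forall>j\<ge>n. f j = (0::real)"
proof
  show "y = vec n (\<lambda>j. if j < n then y $ j else 0)" using assms by auto
qed simp

text \<open>Vectors are handled as functions supported on \<open>{..<n}\<close>, to use the product topology, which the
  type of vectors does not carry.\<close>

definition null_funs :: "nat \<Rightarrow> nat \<Rightarrow> real mat \<Rightarrow> (nat \<Rightarrow> real) set" where
  "null_funs m n A = {x. (\<forall>j\<ge>n. x j = 0) \<and> (\<forall>i<m. dot n (\<lambda>j. A $$ (i, j)) x = 0)}"

lemma l1_ball_kernel_eq:
  assumes A: "A \<in> carrier_mat m n"
  shows "l1_ball_kernel A = vec n ` {x \<in> null_funs m n A. l1 n x \<le> 1}"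
proof (intro equalityI subsetI)
  fix y assume y: "y \<in> l1_ball_kernel A"
  then obtain f where f: "y = vec n f" "\<forall>j\<ge>n. f j = 0"
    using A by (auto simp: l1_ball_kernel_def elim: carrier_vecE)
  then show "y \<in> vec n ` {x \<in> null_funs m n A. l1 n x \<le> 1}"
    using y A by (auto simp: l1_ball_kernel_def l1_norm_vec mult_mat_vec_eq_0_iff[OF A] null_funs_def)
next
  fix y assume "y \<in> vec n ` {x \<in> null_funs m n A. l1 n x \<le> 1}"
  then show "y \<in> l1_ball_kernel A"
    using A by (auto simp: l1_ball_kernel_def l1_norm_vec mult_mat_vec_eq_0_iff[OF A] null_funs_def)
qed

text \<open>Each coordinate of \<open>x\<close> is at most 1 in absolute value. The bound does not
  depend on \<open>x\<close>, so it is an integrable envelope for the supremum that defines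
  \<open>M_star\<close>.\<close>

lemma abs_dot_le: "l1 n x \<le> 1 \<Longrightarrow> \<bar>dot n g x\<bar> \<le> (\<Sum>j<n. \<bar>g j\<bar>)"
proof -
  assume x: "l1 n x \<le> 1"
  have "\<bar>dot n g x\<bar> \<le> (\<Sum>j<n. \<bar>g j * x j\<bar>)" unfolding dot_def by (rule sum_abs)
  also have "\<dots> \<le> (\<Sum>j<n. \<bar>g j\<bar>)"
  proof (rule sum_mono)
    fix j assume "j \<in> {..<n}"
    then have "\<bar>x j\<bar> \<le> 1" using l1_ge_component[of j n x] x by simp
    then show "\<bar>g j * x j\<bar> \<le> \<bar>g j\<bar>" by (simp add: abs_mult mult_left_le)
  qed
  finally show ?thesis .
qed

lemma M_star_eq:
  assumes A: "A \<in> carrier_mat m n"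
  shows "M_star A = (LINT g|iid_std_gaussian {..<n}. (SUP x\<in>{x \<in> null_funs m n A. l1 n x \<le> 1}. dot n g x))"
proof -
  have "dim_col A = n" using A by simp
  then show ?thesis
    unfolding M_star_def M_star_set_def l1_ball_kernel_eq[OF A] image_image by (simp add: scalar_prod_vec)
qed

text \<open>Continuity in \<open>x\<close> reduces the supremum to a countable dense subset, which
  gives measurability. Without integrability the integral would take the default value 0 and
  \<open>M_star\<close> would bound nothing.\<close>

lemma integrable_SUP_dot:
  assumes K: "K \<noteq> {}" "\<And>x. x \<in> K \<Longrightarrow> l1 n x \<le> 1"
  shows "integrable (iid_std_gaussian {..<n}) (\<lambda>g. SUP x\<in>K. dot n g x)"
proof (rule Bochner_Integration.integrable_bound)
  show "integrable (iid_std_gaussian {..<n}) (\<lambda>g. \<Sum>j<n. \<bar>g j\<bar>)"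
    by (intro Bochner_Integration.integrable_sum integrable_abs integrable_gaussian_component)
  obtain D where D: "countable D" "D \<subseteq> K" "K \<subseteq> closure D" by (rule separable)
  have D0: "D \<noteq> {}" using D K by auto
  have bdd: "bdd_above (dot n g ` X)" if "X \<subseteq> K" for X g
  proof (rule bdd_aboveI2)
    fix x assume "x \<in> X"
    then show "dot n g x \<le> (\<Sum>j<n. \<bar>g j\<bar>)" using abs_dot_le[of n x g] K that by auto
  qed
  have eq: "(SUP x\<in>K. dot n g x) = (SUP x\<in>D. dot n g x)" for g
  proof (rule antisym)
    show "(SUP x\<in>D. dot n g x) \<le> (SUP x\<in>K. dot n g x)"
      using D D0 bdd by (intro cSUP_subset_mono) auto
    show "(SUP x\<in>K. dot n g x) \<le> (SUP x\<in>D. dot n g x)"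
    proof (rule cSUP_least[OF K(1)])
      fix x assume "x \<in> K"
      have "closed {x. dot n g x \<le> (SUP x\<in>D. dot n g x)}"
        by (intro closed_Collect_le continuous_on_dot continuous_on_const)
      moreover have "D \<subseteq> {x. dot n g x \<le> (SUP x\<in>D. dot n g x)}"
        using bdd[OF D(2)] by (auto intro: cSUP_upper)
      ultimately have "closure D \<subseteq> {x. dot n g x \<le> (SUP x\<in>D. dot n g x)}"
        by (rule closure_minimal[rotated])
      then show "dot n g x \<le> (SUP x\<in>D. dot n g x)" using D \<open>x \<in> K\<close> by auto
    qed
  qed
  show "(\<lambda>g. SUP x\<in>K. dot n g x) \<in> borel_measurable (iid_std_gaussian {..<n})"
    unfolding eq using D(1)
  proof (rule borel_measurable_cSUP)
    show "(\<lambda>g. dot n g x) \<in> borel_measurable (iid_std_gaussian {..<n})" for x by measurable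
    show "bdd_above ((\<lambda>x. dot n g x) ` D)" for g using bdd[OF D(2)] .
  qed
  show "AE g in iid_std_gaussian {..<n}. norm (SUP x\<in>K. dot n g x) \<le> norm (\<Sum>j<n. \<bar>g j\<bar>)"
  proof (rule AE_I2)
    fix g
    obtain x where x: "x \<in> K" using K by auto
    have "(SUP x\<in>K. dot n g x) \<le> (\<Sum>j<n. \<bar>g j\<bar>)"
      using K abs_dot_le[of n _ g] by (intro cSUP_least) (auto simp: abs_le_iff)
    moreover have "- (\<Sum>j<n. \<bar>g j\<bar>) \<le> dot n g x" using abs_dot_le[of n x g] K x by fastforce
    then have "- (\<Sum>j<n. \<bar>g j\<bar>) \<le> (SUP x\<in>K. dot n g x)"
      using cSUP_upper[OF x bdd[OF order_refl, of g]] by linarith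
    ultimately show "norm (SUP x\<in>K. dot n g x) \<le> norm (\<Sum>j<n. \<bar>g j\<bar>)" by (simp add: sum_nonneg)
  qed
qed

lemma zero_in_null_funs: "(\<lambda>_. 0) \<in> {x \<in> null_funs m n A. l1 n x \<le> 1}"
  by (simp add: null_funs_def dot_def l1_def)

text \<open>Pointwise, a maximum over a finite part of the section is at most the supremum over the
  section. This puts \<open>M_star\<close> into the width hypothesis of
  \<open>small_ball_tail\<close>.\<close>

lemma gauss_sup_le_M_star:
  assumes A: "A \<in> carrier_mat m n" and D: "finite D" "D \<noteq> {}" "D \<subseteq> {x \<in> null_funs m n A. l1 n x \<le> 1}"
    and c: "c \<ge> 0"
  shows "gauss_sup n D (\<lambda>_. 0) c \<le> c * M_star A"
proof -
  let ?K = "{x \<in> null_funs m n A. l1 n x \<le> 1}"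
  have int: "integrable (iid_std_gaussian {..<n}) (\<lambda>g. SUP x\<in>?K. dot n g x)"
    using zero_in_null_funs by (intro integrable_SUP_dot) auto
  have "gauss_sup n D (\<lambda>_. 0) c \<le> (LINT g|iid_std_gaussian {..<n}. c * (SUP x\<in>?K. dot n g x))"
    unfolding gauss_sup_def
  proof (rule integral_mono)
    show "integrable (iid_std_gaussian {..<n}) (\<lambda>g. MAX x\<in>D. 0 + c * dot n g x)"
      using D by (intro integrable_Max_image) (auto intro: integrable_dot)
    show "integrable (iid_std_gaussian {..<n}) (\<lambda>g. c * (SUP x\<in>?K. dot n g x))"
      using int by simp
    fix g
    show "(MAX x\<in>D. 0 + c * dot n g x) \<le> c * (SUP x\<in>?K. dot n g x)"
    proof (rule Max_image_le[OF D(1,2)])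
      fix x assume x: "x \<in> D"
      have "bdd_above (dot n g ` ?K)"
        using abs_dot_le[of n _ g] by (intro bdd_aboveI2[where M = "\<Sum>j<n. \<bar>g j\<bar>"]) (auto simp: abs_le_iff)
      then have "dot n g x \<le> (SUP x\<in>?K. dot n g x)" using D(3) x by (intro cSUP_upper) auto
      then show "0 + c * dot n g x \<le> c * (SUP x\<in>?K. dot n g x)" using c by (simp add: mult_left_mono)
    qed
  qed
  then show ?thesis by (simp add: M_star_eq[OF A])
qed

lemma M_star_nonneg:
  assumes A: "A \<in> carrier_mat m n"
  shows "M_star A \<ge> 0"
proof -
  have "gauss_sup n {\<lambda>_. 0} (\<lambda>_. 0) 1 \<le> 1 * M_star A"
    using zero_in_null_funs by (intro gauss_sup_le_M_star[OF A]) auto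
  then show ?thesis by (simp add: gauss_sup_def dot_def)
qed

section \<open>Unique recovery and the null space property\<close>

text \<open>Tychonoff's theorem: the set is a product of intervals below \<open>n\<close> and of
  singletons \<open>{0}\<close> from \<open>n\<close> on.\<close>

lemma compact_box: "compact {y :: nat \<Rightarrow> real. (\<forall>j<n. \<bar>y j\<bar> \<le> r) \<and> (\<forall>j\<ge>n. y j = 0)}"
proof -
  have compact_PiE: "compactin (product_topology (\<lambda>_. euclidean) UNIV) (PiE UNIV (\<lambda>j::nat. if j < n then {- r..r} else {0::real}))"
    unfolding compactin_PiE by auto
  have box: "y \<in> PiE UNIV (\<lambda>j. if j < n then {- r..r} else {0}) \<longleftrightarrow> (\<forall>j<n. \<bar>y j\<bar> \<le> r) \<and> (\<forall>j\<ge>n. y j = 0)"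
    for y :: "nat \<Rightarrow> real"
  proof -
    have "y j \<in> (if j < n then {- r..r} else {0}) \<longleftrightarrow> (j < n \<longrightarrow> \<bar>y j\<bar> \<le> r) \<and> (j \<ge> n \<longrightarrow> y j = 0)" for j
      by (cases "j < n") (auto simp: abs_le_iff)
    then show ?thesis by (auto simp: PiE_iff)
  qed
  have "PiE UNIV (\<lambda>j. if j < n then {- r..r} else {0}) = {y :: nat \<Rightarrow> real. (\<forall>j<n. \<bar>y j\<bar> \<le> r) \<and> (\<forall>j\<ge>n. y j = 0)}"
    by (intro equalityI subsetI) (simp_all only: box mem_Collect_eq)
  with compact_PiE show ?thesis by (simp add: euclidean_product_topology)
qed

text \<open>Unlike in \<open>null_funs\<close>, the values from \<open>n\<close> on are free; they
  influence neither the constraints nor the objective \<open>l1 n\<close>.\<close>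

definition feasible :: "nat \<Rightarrow> nat \<Rightarrow> nat \<Rightarrow> real mat \<Rightarrow> (nat \<times> nat \<Rightarrow> real) \<Rightarrow> (nat \<Rightarrow> real) \<Rightarrow> (nat \<Rightarrow> real) set" where
  "feasible m n q A G x0 = {y. (\<forall>i<m. dot n (\<lambda>j. A $$ (i, j)) y = dot n (\<lambda>j. A $$ (i, j)) x0)
     \<and> (\<forall>i<q. dot n (\<lambda>j. G (i, j)) y = dot n (\<lambda>j. G (i, j)) x0)}"

lemma feasible_cong: "(\<And>j. j < n \<Longrightarrow> y j = y' j) \<Longrightarrow> y \<in> feasible m n q A G x0 \<longleftrightarrow> y' \<in> feasible m n q A G x0"
  using dot_cong[of n _ _ y y'] by (simp add: feasible_def)

lemma is_lp_solution_vec_iff: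
  assumes A: "A \<in> carrier_mat m n"
  shows "is_lp_solution A (mat q n G) (vec n x0) (vec n x) \<longleftrightarrow>
    x \<in> feasible m n q A G x0 \<and> (\<forall>y\<in>feasible m n q A G x0. l1 n x \<le> l1 n y)"
proof -
  have n: "dim_col A = n" using A by simp
  have dG: "dot n (\<lambda>j. mat q n G $$ (i, j)) y = dot n (\<lambda>j. G (i, j)) y" if "i < q" for i y
    using that by (intro dot_cong) auto
  have feas: "A *\<^sub>v vec n y = A *\<^sub>v vec n x0 \<and> mat q n G *\<^sub>v vec n y = mat q n G *\<^sub>v vec n x0
      \<longleftrightarrow> y \<in> feasible m n q A G x0" for y
    unfolding mult_mat_vec_eq_iff[OF A] mult_mat_vec_eq_iff[OF mat_carrier[of q n G]]
    by (auto simp: feasible_def dG)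
  have "(\<exists>v. (v \<in> carrier_vec n \<and> A *\<^sub>v v = A *\<^sub>v vec n x0 \<and> mat q n G *\<^sub>v v = mat q n G *\<^sub>v vec n x0) \<and> l1_norm v < l1 n x)
     \<longleftrightarrow> (\<exists>y\<in>feasible m n q A G x0. l1 n y < l1 n x)" (is "?L \<longleftrightarrow> ?R")
  proof
    assume ?L
    then obtain v where v: "v \<in> carrier_vec n" "A *\<^sub>v v = A *\<^sub>v vec n x0 \<and> mat q n G *\<^sub>v v = mat q n G *\<^sub>v vec n x0"
      "l1_norm v < l1 n x" by blast
    then obtain f where "v = vec n f" by (auto elim: carrier_vecE)
    then show ?R using v feas[of f] by (auto simp: l1_norm_vec)
  next
    assume ?R
    then obtain y where "y \<in> feasible m n q A G x0" "l1 n y < l1 n x" by blast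
    then show ?L using feas[of y] by (intro exI[of _ "vec n y"]) (auto simp: l1_norm_vec)
  qed
  then show ?thesis
    unfolding is_lp_solution_def is_arg_min_def n l1_norm_vec using feas[of x]
    by (auto simp: not_less)
qed

lemma closed_feasible: "closed (feasible m n q A G x0)"
proof -
  have "feasible m n q A G x0 = (\<Inter>i<m. {y. dot n (\<lambda>j. A $$ (i, j)) y = dot n (\<lambda>j. A $$ (i, j)) x0})
    \<inter> (\<Inter>i<q. {y. dot n (\<lambda>j. G (i, j)) y = dot n (\<lambda>j. G (i, j)) x0})"
    by (auto simp: feasible_def)
  then show ?thesis
    by (auto intro!: closed_Int closed_INT closed_Collect_eq continuous_on_dot continuous_on_const)
qed

text \<open>Points longer than \<open>x0\<close> cannot improve on it, and cutting off the
  coordinates from \<open>n\<close> on changes nothing, so the search is confined to a compact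
  set.\<close>

lemma feasible_minimizer:
  obtains x where "x \<in> feasible m n q A G x0" "\<And>y. y \<in> feasible m n q A G x0 \<Longrightarrow> l1 n x \<le> l1 n y"
proof -
  let ?F = "feasible m n q A G x0"
  let ?B = "?F \<inter> {y. (\<forall>j<n. \<bar>y j\<bar> \<le> l1 n x0) \<and> (\<forall>j\<ge>n. y j = 0)}"
  define tr where "tr y j = (if j < n then y j else 0)" for y :: "nat \<Rightarrow> real" and j
  have tr: "tr y \<in> ?B" "l1 n (tr y) = l1 n y" if y: "y \<in> ?F" "l1 n y \<le> l1 n x0" for y
  proof -
    have "tr y \<in> ?F" using y feasible_cong[of n y "tr y"] by (simp add: tr_def)
    moreover have "\<bar>y j\<bar> \<le> l1 n x0" if "j < n" for j using l1_ge_component[OF that, of y] y by linarith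
    ultimately show "tr y \<in> ?B" by (auto simp: tr_def)
    show "l1 n (tr y) = l1 n y" by (rule l1_cong) (simp add: tr_def)
  qed
  have x0: "x0 \<in> ?F" by (simp add: feasible_def)
  have "compact ?B" by (rule closed_Int_compact[OF closed_feasible compact_box])
  moreover have "?B \<noteq> {}" using tr(1)[OF x0 order_refl] by (rule ex_in_conv[THEN iffD1, OF exI])
  moreover have "continuous_on ?B (l1 n)" by (rule continuous_on_subset[OF continuous_on_l1]) simp
  ultimately have "\<exists>x\<in>?B. \<forall>y\<in>?B. l1 n x \<le> l1 n y" by (rule continuous_attains_inf)
  then obtain x where x: "x \<in> ?B" "\<And>y. y \<in> ?B \<Longrightarrow> l1 n x \<le> l1 n y" by blast
  show thesis
  proof (rule that)
    show "x \<in> ?F" using x by simp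
    fix y assume y: "y \<in> ?F"
    show "l1 n x \<le> l1 n y"
    proof (cases "l1 n y \<le> l1 n x0")
      case True
      then show ?thesis using x(2)[OF tr(1)[OF y]] tr(2)[OF y] by simp
    next
      case False
      then show ?thesis using x(2)[OF tr(1)[OF x0 order_refl]] tr(2)[OF x0 order_refl] by simp
    qed
  qed
qed

text \<open>Normalized violations of the null space property of order \<kappa> in the kernel of
  \<open>A\<close> alone: the set does not depend on \<open>G\<close>, and the normalization makes
  it compact.\<close>

definition bad_directions :: "nat \<Rightarrow> nat \<Rightarrow> real mat \<Rightarrow> real \<Rightarrow> (nat \<Rightarrow> real) set" where
  "bad_directions m n A \<kappa> = {h \<in> null_funs m n A. l1 n h = 1 \<and>
     (\<exists>S\<subseteq>{..<n}. real (card S) \<le> \<kappa> \<and> 1 / 2 \<le> (\<Sum>j\<in>S. \<bar>h j\<bar>))}"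

text \<open>There are finitely many \<open>S\<close>; for each of them the conditions are closed and
  keep \<open>h\<close> in the unit box.\<close>

lemma compact_bad_directions: "compact (bad_directions m n A \<kappa>)"
proof -
  let ?box = "{y. (\<forall>j<n. \<bar>y j\<bar> \<le> (1::real)) \<and> (\<forall>j\<ge>n. y j = 0)}"
  let ?\<S> = "{S. S \<subseteq> {..<n} \<and> real (card S) \<le> \<kappa>}"
  have fin: "finite ?\<S>" by (rule finite_subset[of _ "Pow {..<n}"]) auto
  have box: "h \<in> ?box" if "l1 n h = 1" "\<forall>j\<ge>n. h j = 0" for h
    using that l1_ge_component[of _ n h] by auto
  have eq: "bad_directions m n A \<kappa> = (\<Union>S\<in>?\<S>. (\<Inter>i<m. {h. dot n (\<lambda>j. A $$ (i, j)) h = 0})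
     \<inter> {h. l1 n h = 1} \<inter> {h. 1 / 2 \<le> (\<Sum>j\<in>S. \<bar>h j\<bar>)} \<inter> ?box)" (is "_ = ?R")
  proof (intro equalityI subsetI)
    fix h assume h: "h \<in> bad_directions m n A \<kappa>"
    then have "h \<in> ?box" by (intro box) (auto simp: bad_directions_def null_funs_def)
    with h show "h \<in> ?R" by (auto simp: bad_directions_def null_funs_def)
  next
    fix h assume h: "h \<in> ?R"
    then show "h \<in> bad_directions m n A \<kappa>" by (auto simp: bad_directions_def null_funs_def)
  qed
  have closed1: "closed (\<Inter>i<m. {h. dot n (\<lambda>j. A $$ (i, j)) h = 0})"
    by (rule closed_INT) (simp add: closed_Collect_eq continuous_on_dot)
  have closed2: "closed {h. l1 n h = 1}"
    by (simp add: closed_Collect_eq continuous_on_l1)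
  have closed3: "closed {h :: nat \<Rightarrow> real. 1 / 2 \<le> (\<Sum>j\<in>S. \<bar>h j\<bar>)}" for S
    by (rule closed_Collect_le) (intro continuous_intros continuous_on_product_coordinates)+
  show ?thesis
    unfolding eq
    by (rule compact_UN[OF fin], rule closed_Int_compact[OF _ compact_box])
      (rule closed_Int[OF closed_Int[OF closed1 closed2] closed3])
qed

text \<open>The null space property. One direction yields recovery; the other makes the recovery
  event equal to the event of no common zero, whose measurability can be proved.\<close>

lemma unique_recovery_iff:
  assumes A: "A \<in> carrier_mat m n"
  shows "(\<forall>x0\<in>carrier_vec n. real (card_nz x0) \<le> \<kappa> \<longrightarrow> (\<forall>x. is_lp_solution A (mat q n G) x0 x \<longrightarrow> x = x0))
    \<longleftrightarrow> (\<forall>h\<in>bad_directions m n A \<kappa>. \<exists>i<q. dot n (\<lambda>j. G (i, j)) h \<noteq> 0)" (is "?L \<longleftrightarrow> ?R")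
proof
  assume L: ?L
  show ?R
  proof (rule ballI, rule ccontr)
    fix h assume h: "h \<in> bad_directions m n A \<kappa>" and "\<not> (\<exists>i<q. dot n (\<lambda>j. G (i, j)) h \<noteq> 0)"
    then have Gh: "\<And>i. i < q \<Longrightarrow> dot n (\<lambda>j. G (i, j)) h = 0" by auto
    from h obtain S where S: "S \<subseteq> {..<n}" "real (card S) \<le> \<kappa>" "1 / 2 \<le> (\<Sum>j\<in>S. \<bar>h j\<bar>)"
      and h1: "l1 n h = 1" and Ah: "\<And>i. i < m \<Longrightarrow> dot n (\<lambda>j. A $$ (i, j)) h = 0"
      by (auto simp: bad_directions_def null_funs_def)
    \<comment> \<open>Splitting \<open>h = z - x0\<close> along \<open>S\<close> gives a sparse
      \<open>x0\<close> and a feasible competitor \<open>z\<close> whose \<ell>1 norm is no larger,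
      since \<open>S\<close> carries at least half of the mass.\<close>
    define x0 where "x0 j = (if j \<in> S then - h j else 0)" for j
    define z where "z j = (if j \<in> S then 0 else h j)" for j
    have hz: "h = (\<lambda>j. z j - x0 j)" by (auto simp: x0_def z_def)
    have z: "z \<in> feasible m n q A G x0"
      using Ah Gh unfolding hz dot_diff by (simp add: feasible_def)
    \<comment> \<open>Uniqueness alone could hold vacuously. A minimizer exists, and uniqueness
      identifies it with \<open>x0\<close>; thus \<open>x0\<close> is optimal, hence so is
      \<open>z\<close>.\<close>
    obtain x where x: "x \<in> feasible m n q A G x0" "\<And>y. y \<in> feasible m n q A G x0 \<Longrightarrow> l1 n x \<le> l1 n y"
      using feasible_minimizer[of m n q A G x0] by blast
    have "{j. j < n \<and> x0 j \<noteq> 0} \<subseteq> S" using S(1) by (auto simp: x0_def split: if_splits)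
    moreover have "finite S" using S(1) by (rule finite_subset) simp
    ultimately have "card_nz (vec n x0) \<le> card S" unfolding card_nz_vec by (intro card_mono)
    then have "real (card_nz (vec n x0)) \<le> \<kappa>" using S(2) by linarith
    then have uniq: "is_lp_solution A (mat q n G) (vec n x0) v \<Longrightarrow> v = vec n x0" for v
      using L by auto
    have "is_lp_solution A (mat q n G) (vec n x0) (vec n x)"
      using x by (simp add: is_lp_solution_vec_iff[OF A])
    then have "vec n x = vec n x0" by (rule uniq)
    then have "l1_norm (vec n x) = l1_norm (vec n x0)" by (rule arg_cong)
    then have "l1 n x = l1 n x0" by (simp only: l1_norm_vec)
    moreover have sx0: "l1 n x0 = (\<Sum>j\<in>S. \<bar>h j\<bar>)"
      unfolding l1_def by (rule sum.mono_neutral_cong_right) (use S(1) in \<open>auto simp: x0_def\<close>)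
    moreover have "l1 n z = l1 n h - l1 n x0"
      unfolding l1_def sum_subtractf[symmetric] by (rule sum.cong) (auto simp: x0_def z_def)
    ultimately have "l1 n z \<le> l1 n x" using S(3) h1 by simp
    then have "l1 n z \<le> l1 n y" if "y \<in> feasible m n q A G x0" for y
      using x(2)[OF that] by linarith
    then have "is_lp_solution A (mat q n G) (vec n x0) (vec n z)"
      using z unfolding is_lp_solution_vec_iff[OF A] by blast
    then have "vec n z = vec n x0" by (rule uniq)
    then have zx0: "vec n z $ j = vec n x0 $ j" for j by (rule arg_cong)
    have "z j = x0 j" if "j < n" for j using zx0[of j] that by simp
    then have "l1 n h = l1 n (\<lambda>_. 0)" unfolding hz by (intro l1_cong) simp
    then show False using h1 by (simp add: l1_def)
  qed
next
  assume R: ?R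
  show ?L
  proof (intro ballI impI allI)
    fix v0 v assume v0: "v0 \<in> carrier_vec n" and sparse: "real (card_nz v0) \<le> \<kappa>"
      and sol: "is_lp_solution A (mat q n G) v0 v"
    have "v \<in> carrier_vec n" using sol A by (auto simp: is_lp_solution_def is_arg_min_def)
    then obtain x where x: "v = vec n x" "\<forall>j\<ge>n. x j = 0" by (rule carrier_vecE)
    from v0 obtain x0 where x0: "v0 = vec n x0" "\<forall>j\<ge>n. x0 j = 0" by (rule carrier_vecE)
    from sol have feas: "x \<in> feasible m n q A G x0" and min: "\<And>y. y \<in> feasible m n q A G x0 \<Longrightarrow> l1 n x \<le> l1 n y"
      by (auto simp: x x0 is_lp_solution_vec_iff[OF A])
    define S where "S = {j. j < n \<and> x0 j \<noteq> 0}"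
    define h where "h j = x j - x0 j" for j
    have "l1 n x \<le> l1 n x0" by (rule min) (simp add: feasible_def)
    have "S \<subseteq> {..<n}" "finite S" by (auto simp: S_def)
    have split: "l1 n f = (\<Sum>j\<in>S. \<bar>f j\<bar>) + (\<Sum>j\<in>{..<n} - S. \<bar>f j\<bar>)" for f
      unfolding l1_def using sum.subset_diff[OF \<open>S \<subseteq> {..<n}\<close>, of "\<lambda>j. \<bar>f j\<bar>"] by simp
    \<comment> \<open>The cone condition: off \<open>S\<close> the vectors \<open>x\<close> and
      \<open>h\<close> agree, so optimality of \<open>x\<close> bounds the mass of \<open>h\<close>
      off \<open>S\<close> by its mass on \<open>S\<close>.\<close>
    have "(\<Sum>j\<in>S. \<bar>x0 j\<bar>) - (\<Sum>j\<in>S. \<bar>h j\<bar>) \<le> (\<Sum>j\<in>S. \<bar>x j\<bar>)"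
      unfolding sum_subtractf[symmetric] by (intro sum_mono) (auto simp: h_def)
    moreover have "(\<Sum>j\<in>{..<n} - S. \<bar>x j\<bar>) = (\<Sum>j\<in>{..<n} - S. \<bar>h j\<bar>)" "(\<Sum>j\<in>{..<n} - S. \<bar>x0 j\<bar>) = 0"
      by (auto simp: h_def S_def intro!: sum.cong sum.neutral)
    ultimately have half: "l1 n h / 2 \<le> (\<Sum>j\<in>S. \<bar>h j\<bar>)"
      using \<open>l1 n x \<le> l1 n x0\<close> split[of x] split[of x0] split[of h] by simp
    have "l1 n h = 0"
    proof (rule ccontr)
      assume "l1 n h \<noteq> 0"
      then have pos: "l1 n h > 0" using l1_nonneg[of n h] by simp
      define k where "k j = 1 / l1 n h * h j" for j
      have 0: "dot n g k = 0" if "dot n g x = dot n g x0" for g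
        unfolding k_def dot_scale using that by (simp add: h_def[abs_def] dot_diff)
      have sum_k: "(\<Sum>j\<in>S. \<bar>k j\<bar>) = (\<Sum>j\<in>S. \<bar>h j\<bar>) / l1 n h"
        using pos by (simp add: k_def abs_mult sum_divide_distrib)
      have "1 / 2 * l1 n h \<le> (\<Sum>j\<in>S. \<bar>h j\<bar>)" using half by simp
      then have "1 / 2 \<le> (\<Sum>j\<in>S. \<bar>k j\<bar>)"
        unfolding sum_k using pos by (simp only: pos_le_divide_eq)
      moreover have "l1 n k = 1" unfolding k_def l1_scale using pos by simp
      moreover have "real (card S) \<le> \<kappa>" using sparse by (simp add: x0 card_nz_vec S_def)
      moreover have "k \<in> null_funs m n A"
        using feas 0 x(2) x0(2) by (auto simp: null_funs_def feasible_def k_def h_def)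
      ultimately have "k \<in> bad_directions m n A \<kappa>"
        using \<open>S \<subseteq> {..<n}\<close> by (auto simp: bad_directions_def)
      then obtain i where "i < q" "dot n (\<lambda>j. G (i, j)) k \<noteq> 0" using R by blast
      then show False using 0 feas by (auto simp: feasible_def)
    qed
    then have "\<bar>h j\<bar> \<le> 0" if "j < n" for j using l1_ge_component[OF that, of h] by simp
    then show "v = v0" by (auto simp: x x0 h_def)
  qed
qed

section \<open>The probability of unique recovery\<close>

text \<open>Measurability matters for the lower bound on the probability: a nonmeasurable set has
  \<open>measure\<close> 0.\<close>

lemma measurable_no_common_zero:
  fixes n q :: nat and C :: "(nat \<Rightarrow> real) set"
  assumes C: "compact C"
  shows "{G \<in> space (iid_std_gaussian ({..<q} \<times> {..<n})). \<forall>h\<in>C. \<exists>i<q. dot n (\<lambda>j. G (i, j)) h \<noteq> 0}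
    \<in> sets (iid_std_gaussian ({..<q} \<times> {..<n}))" (is "?E \<in> sets ?M")
proof -
  define v where "v G h = (\<Sum>i<q. \<bar>dot n (\<lambda>j. G (i, j)) h\<bar>)" for G :: "nat \<times> nat \<Rightarrow> real" and h
  have v_pos: "v G h > 0 \<longleftrightarrow> (\<exists>i<q. dot n (\<lambda>j. G (i, j)) h \<noteq> 0)" for G h
  proof -
    have "v G h = 0 \<longleftrightarrow> (\<forall>i<q. dot n (\<lambda>j. G (i, j)) h = 0)"
      unfolding v_def by (subst sum_nonneg_eq_0_iff) auto
    moreover have "v G h \<ge> 0" unfolding v_def by (rule sum_nonneg) simp
    ultimately show ?thesis by (simp add: order_less_le)
  qed
  have v_cont: "continuous_on UNIV (v G)" for G
    unfolding v_def by (intro continuous_intros continuous_on_dot)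
  have [measurable]: "(\<lambda>G. v G h) \<in> borel_measurable ?M" for h
    unfolding v_def dot_def by measurable
  obtain D where D: "countable D" "D \<subseteq> C" "C \<subseteq> closure D" by (rule separable)
  \<comment> \<open>A positive continuous function on a compact set is bounded away from 0, and a
    lower bound on a dense subset extends to the closure. So the event becomes a countable
    combination of measurable ones.\<close>
  have "(\<forall>h\<in>C. v G h > 0) \<longleftrightarrow> (\<exists>k. \<forall>h\<in>D. 1 / real (Suc k) \<le> v G h)" for G
  proof
    assume *: "\<forall>h\<in>C. v G h > 0"
    show "\<exists>k. \<forall>h\<in>D. 1 / real (Suc k) \<le> v G h"
    proof (cases "C = {}")
      case True
      then show ?thesis using D by auto
    next
      case False
      then obtain h0 where h0: "h0 \<in> C" "\<And>h. h \<in> C \<Longrightarrow> v G h0 \<le> v G h"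
        using continuous_attains_inf[OF C False] continuous_on_subset[OF v_cont] by (metis subset_UNIV)
      then obtain k where "inverse (real (Suc k)) < v G h0" using * reals_Archimedean by blast
      then have "1 / real (Suc k) \<le> v G h" if "h \<in> D" for h
        using h0(2)[of h] D(2) that by (auto simp: inverse_eq_divide)
      then show ?thesis by blast
    qed
  next
    assume "\<exists>k. \<forall>h\<in>D. 1 / real (Suc k) \<le> v G h"
    then obtain k where k: "D \<subseteq> {h. 1 / real (Suc k) \<le> v G h}" by blast
    have "closed {h. 1 / real (Suc k) \<le> v G h}"
      by (intro closed_Collect_le v_cont continuous_on_const)
    with k have "closure D \<subseteq> {h. 1 / real (Suc k) \<le> v G h}" by (rule closure_minimal)
    then have "1 / real (Suc k) \<le> v G h" if "h \<in> C" for h using D(3) that by auto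
    moreover have "0 < 1 / real (Suc k)" by simp
    ultimately show "\<forall>h\<in>C. v G h > 0" by (meson less_le_trans)
  qed
  then have "?E = {G \<in> space ?M. \<exists>k. \<forall>h\<in>D. 1 / real (Suc k) \<le> v G h}"
    unfolding v_pos by simp
  also have "\<dots> \<in> sets ?M"
    using D(1) by (intro sets.sets_Collect_countable_Ex sets.sets_Collect_countable_Ball) measurable
  finally show ?thesis .
qed

text \<open>Both laws agree on boxes, where the product over entries is grouped by rows. This turns
  the entries of \<open>G\<close> into independent Gaussian rows.\<close>

lemma iid_std_gaussian_Times:
  assumes I: "finite I" and J: "finite J"
  shows "distr (\<Pi>\<^sub>M i\<in>I. iid_std_gaussian J) (iid_std_gaussian (I \<times> J)) (\<lambda>\<omega>. \<lambda>(i, j)\<in>I \<times> J. \<omega> i j)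
    = iid_std_gaussian (I \<times> J)"
    and "(\<lambda>\<omega>. \<lambda>(i, j)\<in>I \<times> J. \<omega> i j) \<in> measurable (\<Pi>\<^sub>M i\<in>I. iid_std_gaussian J) (iid_std_gaussian (I \<times> J))"
proof -
  let ?Q = "\<Pi>\<^sub>M i\<in>I. iid_std_gaussian J" and ?f = "\<lambda>\<omega>. \<lambda>(i, j)\<in>I \<times> J. \<omega> i j"
  interpret Q: product_prob_space "\<lambda>_::'a. iid_std_gaussian J" UNIV
    by (intro product_prob_space.intro product_sigma_finite.intro product_prob_space_axioms.intro
        prob_space_imp_sigma_finite prob_space_gaussian)
  have component: "(\<lambda>\<omega>. \<omega> i j) \<in> borel_measurable ?Q" if "i \<in> I" "j \<in> J" for i j
    by (rule measurable_compose[OF measurable_component_singleton[OF that(1)]])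
      (simp add: measurable_cong_sets[OF sets_gaussian refl] that(2))
  show f: "?f \<in> measurable ?Q (iid_std_gaussian (I \<times> J))"
    unfolding measurable_cong_sets[OF refl sets_gaussian]
    by (rule measurable_restrict) (auto intro: component)
  have "distr ?Q (iid_std_gaussian (I \<times> J)) ?f = PiM (I \<times> J) (\<lambda>_. std_gauss)"
  proof (rule gauss_prod.PiM_eqI)
    show "finite (I \<times> J)" using I J by simp
    show "sets (distr ?Q (iid_std_gaussian (I \<times> J)) ?f) = sets (PiM (I \<times> J) (\<lambda>_. std_gauss))"
      by (simp add: iid_std_gaussian_def)
    fix A :: "'a \<times> 'b \<Rightarrow> real set" assume A: "\<And>k. k \<in> I \<times> J \<Longrightarrow> A k \<in> sets std_gauss"
    have rows: "(\<Pi>\<^sub>E j\<in>J. A (i, j)) \<in> sets (iid_std_gaussian J)" if "i \<in> I" for i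
      unfolding iid_std_gaussian_def using A that J by (intro sets_PiM_I_finite) auto
    have box: "(\<Pi>\<^sub>E k\<in>I \<times> J. A k) \<in> sets (iid_std_gaussian (I \<times> J))"
      unfolding iid_std_gaussian_def using A I J by (intro sets_PiM_I_finite) auto
    have "emeasure (distr ?Q (iid_std_gaussian (I \<times> J)) ?f) (\<Pi>\<^sub>E k\<in>I \<times> J. A k)
        = emeasure ?Q (?f -` (\<Pi>\<^sub>E k\<in>I \<times> J. A k) \<inter> space ?Q)"
      by (rule emeasure_distr[OF f box])
    also have "?f -` (\<Pi>\<^sub>E k\<in>I \<times> J. A k) \<inter> space ?Q = (\<Pi>\<^sub>E i\<in>I. \<Pi>\<^sub>E j\<in>J. A (i, j))"
      by (auto simp: space_PiM space_gaussian PiE_iff restrict_def extensional_def split: if_splits)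
    also have "emeasure ?Q \<dots> = (\<Prod>i\<in>I. emeasure (iid_std_gaussian J) (\<Pi>\<^sub>E j\<in>J. A (i, j)))"
      by (rule Q.emeasure_PiM[OF I rows])
    also have "\<dots> = (\<Prod>i\<in>I. \<Prod>j\<in>J. emeasure std_gauss (A (i, j)))"
      unfolding iid_std_gaussian_def
      using A J by (intro prod.cong refl gauss_prod.emeasure_PiM) auto
    also have "\<dots> = (\<Prod>k\<in>I \<times> J. emeasure std_gauss (A k))"
      by (simp add: prod.cartesian_product case_prod_beta')
    finally show "emeasure (distr ?Q (iid_std_gaussian (I \<times> J)) ?f) (\<Pi>\<^sub>E k\<in>I \<times> J. A k)
        = (\<Prod>k\<in>I \<times> J. emeasure std_gauss (A k))" .
  qed
  then show "distr ?Q (iid_std_gaussian (I \<times> J)) ?f = iid_std_gaussian (I \<times> J)"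
    unfolding iid_std_gaussian_def .
qed

text \<open>Cauchy-Schwarz on \<open>S\<close> for the mass 1/2. For \<open>\<kappa> = 0\<close> the
  conclusion is absurd, so there are no bad directions.\<close>

lemma bad_directions_norm:
  assumes h: "h \<in> bad_directions m n A \<kappa>"
  shows "1 \<le> 4 * \<kappa> * (\<Sum>j<n. (h j)\<^sup>2)"
proof -
  from h obtain S where S: "S \<subseteq> {..<n}" "real (card S) \<le> \<kappa>" "1 / 2 \<le> (\<Sum>j\<in>S. \<bar>h j\<bar>)"
    by (auto simp: bad_directions_def)
  have "(1 / 2)\<^sup>2 \<le> (\<Sum>j\<in>S. \<bar>h j\<bar>)\<^sup>2" using S(3) by (intro power_mono) auto
  also have "\<dots> \<le> (\<Sum>j\<in>S. \<bar>h j\<bar>\<^sup>2) * real (card S)"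
    using Cauchy_Schwarz_ineq_sum[of "\<lambda>j. \<bar>h j\<bar>" "\<lambda>_. 1" S] by simp
  also have "\<dots> \<le> (\<Sum>j<n. (h j)\<^sup>2) * \<kappa>"
    using S by (intro mult_mono) (auto intro!: sum_mono2 sum_nonneg)
  finally show ?thesis by (simp add: power2_eq_square mult_ac)
qed

lemma prob_bad_directions_hit:
  fixes m n q :: nat and A :: "real mat"
  defines "M \<equiv> iid_std_gaussian ({..<q} \<times> {..<n})"
    and "c \<equiv> 64 / trunc_mean\<^sup>2"
  defines "C \<equiv> bad_directions m n A (real q / (4 * c * (M_star A)\<^sup>2))"
  assumes A: "A \<in> carrier_mat m n" and q: "q > 0"
  shows "measure M {G \<in> space M. \<not> (\<forall>h\<in>C. \<exists>i<q. dot n (\<lambda>j. G (i, j)) h \<noteq> 0)} \<le> exp (- (trunc_mean\<^sup>2 / 2) * q)"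
    (is "measure M ?B \<le> _")
proof (cases "M_star A = 0")
  case True
  \<comment> \<open>Here the sparsity bound is a division by zero, hence 0.\<close>
  have "C = {}" using bad_directions_norm[of _ m n A 0] True by (force simp: C_def)
  then show ?thesis by simp
next
  case False
  then have Mpos: "M_star A > 0" using M_star_nonneg[OF A] by simp
  have c: "c > 0" using trunc_mean_pos by (simp add: c_def)
  \<comment> \<open>This is \<open>sqrt (c / q) * M_star A\<close>. It makes
    \<open>4 * \<kappa> * r\<^sup>2 = 1\<close>, so bad directions have norm at least
    \<open>r\<close>, and makes the width term \<open>2 / r * sqrt q * M_star A\<close> equal to
    \<open>q * trunc_mean / 4\<close>.\<close>
  define r where "r = 8 * M_star A / (trunc_mean * sqrt q)"
  have r: "r > 0" using Mpos q trunc_mean_pos by (simp add: r_def)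
  define \<kappa> where "\<kappa> = real q / (4 * c * (M_star A)\<^sup>2)"
  have \<kappa>: "\<kappa> > 0" using c Mpos q by (simp add: \<kappa>_def)
  have r2: "4 * \<kappa> * r\<^sup>2 = 1"
    using Mpos q trunc_mean_pos by (simp add: \<kappa>_def r_def c_def power_divide power_mult_distrib field_simps)
  define T where "T = {x \<in> null_funs m n A. l1 n x \<le> 1 \<and> (\<Sum>j<n. (x j)\<^sup>2) = r\<^sup>2}"
  let ?Q = "\<Pi>\<^sub>M i\<in>{..<q}. iid_std_gaussian {..<n}"
  let ?f = "\<lambda>\<omega>. \<lambda>(i, j)\<in>{..<q} \<times> {..<n}. \<omega> i j"
  have f: "?f \<in> measurable ?Q M" "distr ?Q M ?f = M"
    unfolding M_def by (rule iid_std_gaussian_Times; simp)+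
  have "{G \<in> space M. \<forall>h\<in>C. \<exists>i<q. dot n (\<lambda>j. G (i, j)) h \<noteq> 0} \<in> sets M"
    unfolding M_def C_def by (intro measurable_no_common_zero compact_bad_directions)
  then have B: "?B \<in> sets M" by (rule sets.sets_Collect_neg)
  have "measure M ?B = measure (distr ?Q M ?f) ?B" by (simp only: f(2))
  also have "\<dots> = measure ?Q (?f -` ?B \<inter> space ?Q)" by (rule measure_distr[OF f(1) B])
  also have "\<dots> \<le> exp (- (trunc_mean\<^sup>2 / 2) * q)"
  proof (rule small_ball_tail[OF r q])
    show "(\<Sum>j<n. (x j)\<^sup>2) = r\<^sup>2" if "x \<in> T" for x using that by (simp add: T_def)
    show "gauss_sup n D (\<lambda>_. 0) (2 / r * sqrt q) \<le> q * trunc_mean / 4"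
      if "finite D" "D \<noteq> {}" "D \<subseteq> T" for D
    proof -
      have "gauss_sup n D (\<lambda>_. 0) (2 / r * sqrt q) \<le> 2 / r * sqrt q * M_star A"
        using that r by (intro gauss_sup_le_M_star[OF A]) (auto simp: T_def)
      also have "\<dots> = (sqrt q * sqrt q) * trunc_mean / 4"
        using Mpos q trunc_mean_pos by (simp add: r_def field_simps)
      finally show ?thesis by simp
    qed
    show "?f -` ?B \<inter> space ?Q \<subseteq> {\<omega> \<in> space ?Q. \<exists>x\<in>T. \<forall>i<q. dot n (\<omega> i) x = 0}"
    proof
      fix \<omega> assume \<omega>: "\<omega> \<in> ?f -` ?B \<inter> space ?Q"
      then obtain h where h: "h \<in> C" "\<forall>i<q. dot n (\<lambda>j. ?f \<omega> (i, j)) h = 0" by auto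
      have z: "dot n (\<omega> i) h = 0" if "i < q" for i
        using h(2) that dot_cong[of n "\<omega> i" "\<lambda>j. ?f \<omega> (i, j)" h h] by simp
      define s where "s = sqrt (\<Sum>j<n. (h j)\<^sup>2)"
      have s2: "s\<^sup>2 = (\<Sum>j<n. (h j)\<^sup>2)" by (simp add: s_def sum_nonneg)
      have "4 * \<kappa> * r\<^sup>2 \<le> 4 * \<kappa> * s\<^sup>2"
        using bad_directions_norm[OF h(1)[unfolded C_def, folded \<kappa>_def]] r2 s2 by simp
      then have "r\<^sup>2 \<le> s\<^sup>2" using \<kappa> by simp
      then have rs: "r \<le> s" by (rule power2_le_imp_le) (simp add: s_def sum_nonneg)
      \<comment> \<open>As \<open>r \<le> s\<close>, this shrinks \<open>h\<close> onto the sphere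
        of radius \<open>r\<close> without leaving the \<ell>1 ball or the kernels.\<close>
      define x where "x j = r / s * h j" for j
      have dot_x: "dot n g x = r / s * dot n g h" for g
        unfolding x_def by (rule dot_scale)
      have "(\<Sum>j<n. (x j)\<^sup>2) = (r / s)\<^sup>2 * s\<^sup>2"
        unfolding s2 x_def power_mult_distrib sum_distrib_left ..
      also have "\<dots> = r\<^sup>2" using rs r by (simp add: power_divide)
      finally have norm_x: "(\<Sum>j<n. (x j)\<^sup>2) = r\<^sup>2" .
      have "h \<in> null_funs m n A" and h1: "l1 n h = 1"
        using h(1) by (auto simp: C_def bad_directions_def)
      then have x_null: "x \<in> null_funs m n A"
        unfolding null_funs_def mem_Collect_eq dot_x by (simp add: x_def)
      have "l1 n x = \<bar>r / s\<bar> * l1 n h" unfolding x_def by (rule l1_scale)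
      then have "l1 n x \<le> 1" using h1 rs r by simp
      with norm_x x_null have "x \<in> T" by (simp add: T_def)
      moreover have "\<forall>i<q. dot n (\<omega> i) x = 0" unfolding dot_x using z by simp
      ultimately show "\<omega> \<in> {\<omega> \<in> space ?Q. \<exists>x\<in>T. \<forall>i<q. dot n (\<omega> i) x = 0}" using \<omega> by blast
    qed
  qed
  finally show ?thesis .
qed

theorem proposition2p4:
  shows "\<exists>c c' :: real. c > 0 \<and> c' > 0 \<and>
    (\<forall>(m::nat) (n::nat) (q::nat) (A::real mat).
       0 < m \<longrightarrow> m < n \<longrightarrow> 0 < q \<longrightarrow> A \<in> carrier_mat m n \<longrightarrow>
       \<P>(G in iid_std_gaussian ({..<q} \<times> {..<n}).
          \<forall>x0 \<in> carrier_vec n.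
            real (card_nz x0) \<le> real q / (4 * c * (M_star A)\<^sup>2) \<longrightarrow>
            (\<forall>x. is_lp_solution A (mat q n G) x0 x \<longrightarrow> x = x0))
       \<ge> 1 - exp (- c' * real q))"
proof (intro exI conjI allI impI)
  let ?c = "64 / trunc_mean\<^sup>2" and ?c' = "trunc_mean\<^sup>2 / 2"
  show "?c > 0" "?c' > 0" using trunc_mean_pos by simp_all
  fix m n q :: nat and A :: "real mat"
  assume q: "0 < q" and A: "A \<in> carrier_mat m n"
  let ?M = "iid_std_gaussian ({..<q} \<times> {..<n})"
  let ?C = "bad_directions m n A (real q / (4 * ?c * (M_star A)\<^sup>2))"
  let ?E = "{G \<in> space ?M. \<forall>h\<in>?C. \<exists>i<q. dot n (\<lambda>j. G (i, j)) h \<noteq> 0}"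
  interpret M: prob_space ?M by (rule prob_space_gaussian)
  have E: "?E \<in> sets ?M" by (intro measurable_no_common_zero compact_bad_directions)
  have "space ?M - ?E = {G \<in> space ?M. \<not> (\<forall>h\<in>?C. \<exists>i<q. dot n (\<lambda>j. G (i, j)) h \<noteq> 0)}" by blast
  then have "M.prob (space ?M - ?E) \<le> exp (- ?c' * q)"
    using prob_bad_directions_hit[OF A q] by simp
  then have "1 - exp (- ?c' * q) \<le> M.prob ?E" using M.prob_compl[OF E] by simp
  then show "\<P>(G in ?M. \<forall>x0 \<in> carrier_vec n. real (card_nz x0) \<le> real q / (4 * ?c * (M_star A)\<^sup>2) \<longrightarrow>
            (\<forall>x. is_lp_solution A (mat q n G) x0 x \<longrightarrow> x = x0)) \<ge> 1 - exp (- ?c' * real q)"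
    \<comment> \<open>The recovery event is rewritten as the equal set \<open>?E\<close>, for which
      the bound is already proved.\<close>
    by (simp only: unique_recovery_iff[OF A])
qed

end
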